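(* Consider any sequence of weakly dense graphs $H=H_n$ ($n\in\mathbb N$), with $H_n$ a subgraph of the complete graph $K_n$, and let $q\in[0,1)$. Consider the planted subgraph model corresponding to $H_n$ with noise level $p=p_n\in(0,1)$, with normalized minimum mean squared error $\mathrm{MMSE}_n(p)$, and let $\varphi_q=(\varphi_q)_n$ be the $q$-modified subgraph expectation threshold of $H_n$. Then, as $n\to\infty$: (a) If $\liminf_n p/\varphi_q>1$, then $\liminf_n \mathrm{MMSE}_n(p)\ge 1-q$. (b) If $\limsup_n p/\varphi_q<1$, then $\limsup_n \mathrm{MMSE}_n(p)\le 1-q$. In particular, for any constant $q\in[0,1)$, there exists some sequence of noise levels $p=p_n$ satisfying $\lim_n p/\varphi_q=1$ for which $\lim_n\mathrm{MMSE}_n(p)=1-q$.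
   Context: A graph $T$ on vertex set $[n]$ is identified with its edge set $T\subseteq\binom{[n]}{2}$; $|T|$ is its number of edges, $V(T)$ is the set of vertices incident to at least one edge of $T$, and $v(T)=|V(T)|$. Subgraph means subset of edges. A sequence of graphs $H=H_n\subseteq K_n$ is weakly dense if $\liminf_n \frac{|H_n|}{v(H_n)\log v(H_n)}=+\infty$. Planted subgraph model: $H^*$ is a uniformly random copy (isomorphic image under relabeling of vertices) of $H_n$ in $K_n$, $G_0\sim G(n,p)$ is an independent Erdős–Rényi graph, and one observes $G=H^*\cup G_0$ (union of edge sets). The normalized minimum mean squared error is $$\mathrm{MMSE}_n(p)=\frac1{|H|}\min_{\hat A}\mathbb E\|\mathbf 1_{H^*}-\hat A(G)\|_2^2=\frac1{|H|}\mathbb E\big[\|\mathbf 1_{H^*}-\mathbb E[\mathbf 1_{H^*}\mid G]\|_2^2\big],$$ where $\mathbf 1_{H^*}\in\{0,1\}^{\binom n2}$ is the indicator vector of the edges of $H^*$. For $q\in[0,1)$, $$\varphi_q=(\varphi_q)_n=\min\Big\{\max\big\{n^{-\frac{|V(J)\setminus V(S)|}{|J\setminus S|}}: J\subseteq H,\ J\supsetneq S\big\}: S\subseteq H,\ |S|\le q|H|\Big\}.$$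
   Formalization: The final "in particular" is stated only when limsup |H_n|/C(n,2) ≤ q; without this it is false (for H_n = K_n the MMSE is 0 for every p), and the condition is necessary, since MMSE_n(p) ≤ 1 − |H_n|/C(n,2) for all p. *)

theory Defs
  imports "HOL-Probability.Probability" "HOL-Library.Ramsey"
begin

section \<open>Graphs on \<open>[n]\<close> as edge sets\<close>

type_synonym graph = "nat set set"

definition complete_graph :: "nat \<Rightarrow> graph" where
  "complete_graph n = [{1..n}]\<^bsup>2\<^esup>"

definition vertices :: "graph \<Rightarrow> nat set" where
  "vertices T = \<Union>T"

definition weakly_dense :: "(nat \<Rightarrow> graph) \<Rightarrow> bool" where
  "weakly_dense H \<longleftrightarrow>
     liminf (\<lambda>n. ereal (real (card (H n)) /
        (real (card (vertices (H n))) * ln (real (card (vertices (H n))))))) = \<infinity>"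

section \<open>The planted subgraph model\<close>

definition copies :: "nat \<Rightarrow> graph \<Rightarrow> graph set" where
  "copies n H = {(`) \<pi> ` H | \<pi>. \<pi> permutes {1..n}}"

definition erdos_renyi :: "nat \<Rightarrow> real \<Rightarrow> graph pmf" where
  "erdos_renyi n p =
     map_pmf (\<lambda>f. {e \<in> complete_graph n. f e})
       (Pi_pmf (complete_graph n) False (\<lambda>_. bernoulli_pmf p))"

text \<open>The joint law of the hidden copy and the noise graph.\<close>

definition planted :: "nat \<Rightarrow> graph \<Rightarrow> real \<Rightarrow> (graph \<times> graph) pmf" where
  "planted n H p = pair_pmf (pmf_of_set (copies n H)) (erdos_renyi n p)"

definition observed :: "graph \<times> graph \<Rightarrow> graph" where
  "observed \<omega> = fst \<omega> \<union> snd \<omega>"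

text \<open>An estimator maps the observed graph to a vector indexed by the edges of the complete
  graph; its values at other index sets are irrelevant.\<close>

definition mse :: "nat \<Rightarrow> graph \<Rightarrow> real \<Rightarrow> (graph \<Rightarrow> nat set \<Rightarrow> real) \<Rightarrow> real" where
  "mse n H p A = measure_pmf.expectation (planted n H p)
     (\<lambda>\<omega>. \<Sum>e\<in>complete_graph n. (indicator (fst \<omega>) e - A (observed \<omega>) e)\<^sup>2)"

text \<open>The infimum is attained at the posterior mean, see \<open>mmse_eq_posterior_mean\<close> below.\<close>

definition mmse :: "nat \<Rightarrow> graph \<Rightarrow> real \<Rightarrow> real" where
  "mmse n H p = (INF A. mse n H p A) / real (card H)"

definition posterior_mean :: "nat \<Rightarrow> graph \<Rightarrow> real \<Rightarrow> graph \<Rightarrow> nat set \<Rightarrow> real" where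
  "posterior_mean n H p g e =
     measure_pmf.expectation (cond_pmf (planted n H p) {\<omega>. observed \<omega> = g})
       (\<lambda>\<omega>. indicator (fst \<omega>) e)"

section \<open>The modified subgraph expectation threshold\<close>

text \<open>For \<open>q < 1\<close> and \<open>H\<close> finite and nonempty both index sets are finite and nonempty;
  for \<open>H = {}\<close> the value is unspecified.\<close>

definition expectation_threshold :: "real \<Rightarrow> nat \<Rightarrow> graph \<Rightarrow> real" where
  "expectation_threshold q n H =
     (MIN S\<in>{S. S \<subseteq> H \<and> real (card S) \<le> q * real (card H)}.
        MAX J\<in>{J. J \<subseteq> H \<and> S \<subset> J}.
          real n powr (- (real (card (vertices J - vertices S)) / real (card (J - S)))))"

section \<open>Basic facts\<close>

lemma finite_complete_graph [simp]: "finite (complete_graph n)"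
  by (simp add: complete_graph_def finite_imp_finite_nsets)

lemma finite_copies: "finite (copies n H)"
  using finite_permutations[of "{1..n}"] by (simp add: copies_def Setcompr_eq_image)

lemma copies_nonempty: "copies n H \<noteq> {}"
  unfolding copies_def using permutes_id[of "{1..n}"] by blast

lemma copies_subset:
  assumes "H \<subseteq> complete_graph n" "K \<in> copies n H"
  shows "K \<subseteq> complete_graph n" "card K = card H"
proof -
  obtain \<pi> where \<pi>: "\<pi> permutes {1..n}" and K: "K = (`) \<pi> ` H"
    using assms(2) unfolding copies_def by blast
  have "\<pi> ` e \<in> complete_graph n" if "e \<in> complete_graph n" for e
  proof -
    have "\<pi> ` e \<subseteq> \<pi> ` {1..n}"
      using that by (intro image_mono) (auto simp: complete_graph_def nsets_def)
    moreover have "card (\<pi> ` e) = card e"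
      by (intro card_image inj_on_subset[OF permutes_inj[OF \<pi>]]) auto
    ultimately show ?thesis
      using that permutes_image[OF \<pi>] by (auto simp: complete_graph_def nsets_def)
  qed
  thus "K \<subseteq> complete_graph n" using assms(1) K by auto
  have "inj ((`) \<pi>)" using permutes_inj[OF \<pi>] by (simp add: inj_image_eq_iff inj_def)
  thus "card K = card H" unfolding K by (metis card_image inj_on_subset subset_UNIV)
qed

lemma finite_set_planted [simp]: "finite (set_pmf (planted n H p))"
proof -
  have "set_pmf (erdos_renyi n p) \<subseteq> Pow (complete_graph n)"
    by (auto simp: erdos_renyi_def)
  hence "finite (set_pmf (erdos_renyi n p))" by (rule finite_subset) simp
  thus ?thesis
    by (simp add: planted_def finite_copies copies_nonempty)
qed

lemma mse_nonneg: "0 \<le> mse n H p A"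
  unfolding mse_def by (intro Bochner_Integration.integral_nonneg sum_nonneg) auto

lemma mmse_le_mse: "mmse n H p \<le> mse n H p A / real (card H)"
  unfolding mmse_def
  by (intro divide_right_mono cINF_lower bdd_belowI[of _ 0]) (auto simp: mse_nonneg)

lemma mse_posterior_mean_le: "mse n H p (posterior_mean n H p) \<le> mse n H p A"
proof -
  let ?P = "planted n H p"
  let ?Q = "map_pmf observed ?P"
  let ?C = "\<lambda>g. cond_pmf ?P {\<omega>. observed \<omega> = g}"
  let ?K = "complete_graph n"
  have ne: "set_pmf ?P \<inter> {\<omega>. observed \<omega> = g} \<noteq> {}" if "g \<in> set_pmf ?Q" for g
    using that by auto
  have dec: "?P = bind_pmf ?Q ?C"
  proof -
    have "?P = bind_pmf ?P (\<lambda>x. cond_pmf ?P {y. observed y = observed x})"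
    proof (rule bind_cond_pmf_cancel[symmetric])
      fix x y
      show "set_pmf ?P \<inter> {y. observed y = observed x} \<noteq> {}" if "x \<in> set_pmf ?P"
        using that by blast
      show "set_pmf ?P \<inter> {x. observed y = observed x} \<noteq> {}" if "y \<in> set_pmf ?P"
        using that by blast
      show "measure ?P {y. observed y = observed x} = measure ?P {x. observed y = observed x}"
        if "observed y = observed x"
        using that by (simp add: eq_commute)
    qed
    thus ?thesis by (simp add: bind_map_pmf)
  qed
  have fin: "finite (set_pmf (?C g))" if "g \<in> set_pmf ?Q" for g
    using set_cond_pmf[OF ne[OF that]] by simp
  have mse: "mse n H p B = (\<Sum>g\<in>set_pmf ?Q. pmf ?Q g * (\<Sum>e\<in>?K.
      measure_pmf.expectation (?C g) (\<lambda>\<omega>. (indicator (fst \<omega>) e - B g e)\<^sup>2)))" for B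
  proof -
    have "mse n H p B = (\<Sum>g\<in>set_pmf ?Q. pmf ?Q g *\<^sub>R measure_pmf.expectation (?C g)
        (\<lambda>\<omega>. \<Sum>e\<in>?K. (indicator (fst \<omega>) e - B (observed \<omega>) e)\<^sup>2))"
      unfolding mse_def by (subst dec, rule pmf_expectation_bind) (auto simp: fin)
    also have "\<dots> = (\<Sum>g\<in>set_pmf ?Q. pmf ?Q g * (\<Sum>e\<in>?K.
      measure_pmf.expectation (?C g) (\<lambda>\<omega>. (indicator (fst \<omega>) e - B g e)\<^sup>2)))"
    proof (rule sum.cong[OF refl])
      fix g assume g: "g \<in> set_pmf ?Q"
      have "measure_pmf.expectation (?C g)
          (\<lambda>\<omega>. \<Sum>e\<in>?K. (indicator (fst \<omega>) e - B (observed \<omega>) e)\<^sup>2) =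
        measure_pmf.expectation (?C g) (\<lambda>\<omega>. \<Sum>e\<in>?K. (indicator (fst \<omega>) e - B g e)\<^sup>2)"
        using set_cond_pmf[OF ne[OF g]] by (intro integral_cong_AE) (auto simp: AE_measure_pmf_iff)
      also have "\<dots> = (\<Sum>e\<in>?K.
          measure_pmf.expectation (?C g) (\<lambda>\<omega>. (indicator (fst \<omega>) e - B g e)\<^sup>2))"
        by (intro Bochner_Integration.integral_sum integrable_measure_pmf_finite fin g)
      finally show "pmf ?Q g *\<^sub>R measure_pmf.expectation (?C g)
          (\<lambda>\<omega>. \<Sum>e\<in>?K. (indicator (fst \<omega>) e - B (observed \<omega>) e)\<^sup>2) = pmf ?Q g * (\<Sum>e\<in>?K.
          measure_pmf.expectation (?C g) (\<lambda>\<omega>. (indicator (fst \<omega>) e - B g e)\<^sup>2))"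
        by simp
    qed
    finally show ?thesis .
  qed
  have sq: "measure_pmf.expectation (?C g) (\<lambda>\<omega>. (indicator (fst \<omega>) e - b)\<^sup>2) =
      measure_pmf.expectation (?C g) (\<lambda>\<omega>. (indicator (fst \<omega>) e)\<^sup>2)
        - (posterior_mean n H p g e)\<^sup>2 + (posterior_mean n H p g e - b)\<^sup>2"
    if g: "g \<in> set_pmf ?Q" for g e and b :: real
  proof -
    note [simp] = integrable_measure_pmf_finite[OF fin[OF g]]
    have "measure_pmf.expectation (?C g) (\<lambda>\<omega>. (indicator (fst \<omega>) e - b)\<^sup>2) =
      measure_pmf.expectation (?C g)
        (\<lambda>\<omega>. (indicator (fst \<omega>) e)\<^sup>2 + ((- 2 * b) * indicator (fst \<omega>) e + b\<^sup>2))"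
      by (intro arg_cong[where f = "measure_pmf.expectation (?C g)"] ext)
        (simp add: power2_eq_square algebra_simps)
    also have "\<dots> = measure_pmf.expectation (?C g) (\<lambda>\<omega>. (indicator (fst \<omega>) e)\<^sup>2)
        + ((- 2 * b) * posterior_mean n H p g e + b\<^sup>2)"
      by (subst Bochner_Integration.integral_add, simp, simp,
          subst Bochner_Integration.integral_add, simp, simp) (simp add: posterior_mean_def)
    finally show ?thesis by (simp add: power2_eq_square algebra_simps)
  qed
  show ?thesis
    unfolding mse
    by (intro sum_mono mult_left_mono) (simp_all add: sq)
qed

theorem mmse_eq_posterior_mean: "mmse n H p = mse n H p (posterior_mean n H p) / real (card H)"
proof -
  have "(INF A. mse n H p A) = mse n H p (posterior_mean n H p)"
    by (rule cInf_eq_minimum) (auto simp: mse_posterior_mean_le)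
  thus ?thesis by (simp add: mmse_def)
qed

text \<open>The best constant estimator gives an upper bound that does not depend on the noise level.\<close>

lemma mmse_le_one_minus_density:
  assumes "H \<subseteq> complete_graph n" "H \<noteq> {}"
  shows "mmse n H p \<le> 1 - real (card H) / real (card (complete_graph n))"
proof -
  let ?K = "complete_graph n"
  define c where "c = real (card H) / real (card ?K)"
  have fH: "finite H" using assms(1) finite_complete_graph by (rule finite_subset)
  have K0: "card ?K > 0" using assms by (auto simp: card_gt_0_iff)
  have H0: "card H > 0" using assms fH by (auto simp: card_gt_0_iff)
  have "mse n H p (\<lambda>_ _. c) = measure_pmf.expectation (planted n H p) (\<lambda>_. real (card H) * (1 - c))"
    unfolding mse_def
  proof (intro integral_cong_AE)
    show "AE \<omega> in planted n H p.
        (\<Sum>e\<in>?K. (indicator (fst \<omega>) e - c)\<^sup>2) = real (card H) * (1 - c)"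
    proof (unfold AE_measure_pmf_iff, intro ballI)
      fix \<omega> assume "\<omega> \<in> set_pmf (planted n H p)"
      hence cp: "fst \<omega> \<in> copies n H"
        by (auto simp: planted_def finite_copies copies_nonempty)
      have ind: "(\<Sum>e\<in>?K. indicator (fst \<omega>) e) = real (card H)"
        using copies_subset[OF assms(1) cp]
        by (simp add: indicator_def sum.If_cases Int_absorb1)
      have "(\<Sum>e\<in>?K. (indicator (fst \<omega>) e - c)\<^sup>2) =
          (\<Sum>e\<in>?K. (1 - 2 * c) * indicator (fst \<omega>) e + c\<^sup>2)"
        by (intro sum.cong) (auto simp: indicator_def power2_eq_square algebra_simps)
      also have "\<dots> = (1 - 2 * c) * real (card H) + real (card ?K) * c\<^sup>2"
        unfolding sum.distrib sum_distrib_left[symmetric] ind by simp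
      also have "\<dots> = real (card H) * (1 - c)"
        using K0 by (simp add: c_def power2_eq_square field_simps)
      finally show "(\<Sum>e\<in>?K. (indicator (fst \<omega>) e - c)\<^sup>2) = real (card H) * (1 - c)" .
    qed
  qed auto
  hence "mse n H p (\<lambda>_ _. c) / real (card H) = 1 - c" using H0 by simp
  thus ?thesis using mmse_le_mse[of n H p "\<lambda>_ _. c"] by (simp add: c_def)
qed

text \<open>Hence an MMSE limit \<open>1 - q\<close> requires that the edge density of \<open>H\<close> in the complete graph is
  asymptotically at most \<open>q\<close>. Weakly dense sequences can violate this, e.g.
  \<open>H = complete_graph\<close>, for which the MMSE is 0.\<close>

lemma limsup_density_le:
  assumes sub: "\<And>n. H n \<subseteq> complete_graph n" and dense: "weakly_dense H"
    and lim: "(\<lambda>n. mmse n (H n) (p n)) \<longlonglongrightarrow> 1 - q"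
  shows "limsup (\<lambda>n. ereal (real (card (H n)) / real (card (complete_graph n)))) \<le> ereal q"
proof -
  have "eventually (\<lambda>n. 0 < ereal (real (card (H n)) /
      (real (card (vertices (H n))) * ln (real (card (vertices (H n))))))) sequentially"
    by (rule less_LiminfD) (use dense in \<open>simp add: weakly_dense_def\<close>)
  hence "eventually (\<lambda>n. ereal (real (card (H n)) / real (card (complete_graph n)))
      \<le> ereal (1 - mmse n (H n) (p n))) sequentially"
  proof eventually_elim
    case (elim n)
    hence "H n \<noteq> {}" by auto
    thus ?case using mmse_le_one_minus_density[OF sub, of n "p n"] by simp
  qed
  hence "limsup (\<lambda>n. ereal (real (card (H n)) / real (card (complete_graph n))))
      \<le> limsup (\<lambda>n. ereal (1 - mmse n (H n) (p n)))"
    by (rule Limsup_mono)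
  also have "(\<lambda>n. 1 - mmse n (H n) (p n)) \<longlonglongrightarrow> q"
    using tendsto_diff[OF tendsto_const[of 1] lim] by simp
  hence "limsup (\<lambda>n. ereal (1 - mmse n (H n) (p n))) = ereal q"
    by (intro lim_imp_Limsup) auto
  finally show ?thesis .
qed

end

theory Submission
  imports Defs
begin

text \<open>Given \<open>G\<close>, the hidden copy is uniform over the copies of \<open>H\<close> in \<open>G\<close>, so
  \<open>1 - MMSE\<close> is the expected fraction of edges shared by \<open>H\<^sup>*\<close> and a random copy of \<open>H\<close> in \<open>G\<close>.
  Above the threshold, reveal the image of a minimising set \<open>S\<close> (this only decreases the error): by a
  second moment computation, a further overlap of \<open>\<delta> |H|\<close> edges contributes
  at most \<open>(v + 1)\<^sup>v (1 + \<epsilon>)\<close> to the power \<open>- \<delta> |H|\<close>, which weak density makes negligible.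
  Below the threshold, chain the sets \<open>J\<close> of the definition: a copy of \<open>H\<close> in \<open>G\<close> that
  meets \<open>H\<^sup>*\<close> in a set \<open>T\<close> of fewer than \<open>(q - \<delta>) |H|\<close> edges contains
  an extension of \<open>T\<close> to more than \<open>q |H|\<close> edges whose new edges all lie in the noise, and a union bound
  excludes this. At criticality the MMSE is continuous in \<open>p\<close> and the intermediate value theorem
  applies; where \<open>(1 + \<epsilon>) \<phi> > 1\<close> the value \<open>1 - |H| / |K\<^sub>n|\<close> at \<open>p = 1\<close> serves as
  the upper end, which is where the density assumption enters.\<close>

section \<open>The planted model as a sum over permutations\<close>

text \<open>Both directions must survive an entropy count. A union bound over edge sets costs up to
  2 to the power |H|, which a gain of (1 + \<epsilon>) or 1 / (1 - \<epsilon>) to the power \<delta>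
  |H| does not repay for small \<epsilon>. So all choices are counted through vertex data, of which
  there are only exp(O(v log v)) many; weak density makes |H| large against v log v. The obstacle in
  the lower bound is that the number of copies of H in G need not concentrate: a part of H can be so
  rare in the noise that a plain second moment over all copies is far too large. Among copies
  through a fixed image of S, only overlaps J beyond S are charged. Such a J costs p to the power
  -|J - S|, while its set U of vertices outside S is sent back into V(H) with probability at most
  (v/n)^|U|. The threshold is what balances n^|U| against p^|J - S|, and the margin \<epsilon>
  supplies the decay. Permutations stand in for copies because they compose: this allows the
  conditioning on S and reduces an overlap of two copies to an overlap with H itself.\<close>

definition edge_image :: "(nat \<Rightarrow> nat) \<Rightarrow> graph \<Rightarrow> graph" where
  "edge_image \<pi> H = (`) \<pi> ` H"

definition supergraphs :: "nat \<Rightarrow> graph \<Rightarrow> graph set" where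
  "supergraphs n R = {g. R \<subseteq> g \<and> g \<subseteq> complete_graph n}"

definition weight :: "nat \<Rightarrow> real \<Rightarrow> graph \<Rightarrow> real" where
  "weight n p g = p ^ card g * (1 - p) ^ (card (complete_graph n) - card g)"

definition sq_dist :: "nat \<Rightarrow> graph \<Rightarrow> (nat set \<Rightarrow> real) \<Rightarrow> real" where
  "sq_dist n X a = (\<Sum>e\<in>complete_graph n. (indicator X e - a e)\<^sup>2)"

section \<open>Product weights of edge sets and the law of the noise\<close>

lemma finite_supergraphs [simp]: "finite (supergraphs n R)"
  unfolding supergraphs_def by (rule finite_subset[of _ "Pow (complete_graph n)"]) auto

lemma weight_nonneg: "0 \<le> p \<Longrightarrow> p \<le> 1 \<Longrightarrow> 0 \<le> weight n p g"
  by (simp add: weight_def)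

lemma sum_Pow_binomial:
  fixes p :: real
  assumes "finite A"
  shows "(\<Sum>u\<in>Pow A. p ^ card u * (1 - p) ^ (card A - card u)) = 1"
proof -
  have "(\<Prod>x\<in>A. p + (1 - p)) = (\<Sum>u\<in>Pow A. (\<Prod>x\<in>u. p) * (\<Prod>x\<in>A - u. 1 - p))"
    by (rule prod_add[OF assms])
  also have "\<dots> = (\<Sum>u\<in>Pow A. p ^ card u * (1 - p) ^ (card A - card u))"
    using assms by (intro sum.cong) (auto simp: card_Diff_subset finite_subset)
  finally show ?thesis by simp
qed

lemma supergraphs_eq_image:
  assumes "R \<subseteq> complete_graph n"
  shows "supergraphs n R = (\<lambda>u. R \<union> u) ` Pow (complete_graph n - R)"
proof -
  have "g \<in> (\<lambda>u. R \<union> u) ` Pow (complete_graph n - R)" if "g \<in> supergraphs n R" for g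
    using that by (intro image_eqI[of _ _ "g - R"]) (auto simp: supergraphs_def)
  thus ?thesis using assms by (auto simp: supergraphs_def)
qed

lemma sum_supergraphs:
  assumes R: "R \<subseteq> complete_graph n"
  shows "(\<Sum>g\<in>supergraphs n R. weight n p g * h g) = p ^ card R *
    (\<Sum>u\<in>Pow (complete_graph n - R). p ^ card u * (1 - p) ^ (card (complete_graph n - R) - card u) * h (R \<union> u))"
proof -
  let ?K = "complete_graph n"
  have fR: "finite R" using R finite_complete_graph by (rule finite_subset)
  have "inj_on (\<lambda>u. R \<union> u) (Pow (?K - R))" by (auto simp: inj_on_def)
  hence "(\<Sum>g\<in>supergraphs n R. weight n p g * h g) =
      (\<Sum>u\<in>Pow (?K - R). weight n p (R \<union> u) * h (R \<union> u))"
    by (simp add: supergraphs_eq_image[OF R] sum.reindex)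
  also have "\<dots> = (\<Sum>u\<in>Pow (?K - R). p ^ card R *
      (p ^ card u * (1 - p) ^ (card (?K - R) - card u) * h (R \<union> u)))"
  proof (rule sum.cong[OF refl])
    fix u assume u: "u \<in> Pow (?K - R)"
    hence "finite u" using finite_subset[OF _ finite_complete_graph, of u n] by blast
    hence "card (R \<union> u) = card R + card u" using fR u by (subst card_Un_disjoint) auto
    thus "weight n p (R \<union> u) * h (R \<union> u) = p ^ card R *
      (p ^ card u * (1 - p) ^ (card (?K - R) - card u) * h (R \<union> u))"
      using R fR by (simp add: weight_def power_add card_Diff_subset)
  qed
  finally show ?thesis by (simp add: sum_distrib_left)
qed

lemma sum_weight_supergraphs:
  assumes "R \<subseteq> complete_graph n"
  shows "(\<Sum>g\<in>supergraphs n R. weight n p g) = p ^ card R"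
  using sum_supergraphs[OF assms, of p "\<lambda>_. 1"] by (simp add: sum_Pow_binomial)

text \<open>The edges of \<open>R\<close> are observed whatever the noise does on them, so the noise
  inside \<open>R\<close> integrates to 1; the weight of the union contains in addition the factor
  \<open>p ^ card R\<close>. This factor is the same for all copies of \<open>H\<close>, which is
  why the posterior is uniform on the copies inside \<open>g\<close>.\<close>

lemma sum_weight_union:
  assumes R: "R \<subseteq> complete_graph n" and p: "0 < p"
  shows "(\<Sum>g\<in>Pow (complete_graph n). weight n p g * h (R \<union> g)) =
    (\<Sum>g\<in>supergraphs n R. weight n p g * h g) / p ^ card R"
proof -
  let ?K = "complete_graph n"
  let ?w = "\<lambda>A u. p ^ card u * (1 - p) ^ (card A - card u)"
  have fR: "finite R" using R finite_complete_graph by (rule finite_subset)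
  have "(\<Sum>g\<in>Pow ?K. weight n p g * h (R \<union> g)) =
      (\<Sum>(t, u)\<in>Pow R \<times> Pow (?K - R). ?w R t * (?w (?K - R) u * h (R \<union> u)))"
  proof (rule sum.reindex_bij_witness[of _ "\<lambda>(t, u). t \<union> u" "\<lambda>g. (g \<inter> R, g - R)"], goal_cases)
    case (5 g)
    have fg: "finite g" using 5 finite_subset[OF _ finite_complete_graph, of g n] by blast
    have c: "card g = card (g \<inter> R) + card (g - R)"
      using fg by (metis card_Int_Diff)
    have cK: "card ?K = card R + card (?K - R)"
      using R fR by (metis card_Diff_subset card_mono finite_complete_graph le_add_diff_inverse)
    have le: "card (g \<inter> R) \<le> card R" "card (g - R) \<le> card (?K - R)"
      using fR 5 by (auto intro!: card_mono)
    have "R \<union> (g - R) = R \<union> g" by auto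
    moreover have "card ?K - card g = (card R - card (g \<inter> R)) + (card (?K - R) - card (g - R))"
      using c cK le by linarith
    ultimately show ?case by (simp add: weight_def c power_add)
  qed (use R in auto)
  also have "\<dots> = (\<Sum>t\<in>Pow R. ?w R t) * (\<Sum>u\<in>Pow (?K - R). ?w (?K - R) u * h (R \<union> u))"
    by (simp add: sum.cartesian_product[symmetric] sum_product)
  also have "\<dots> = (\<Sum>u\<in>Pow (?K - R). ?w (?K - R) u * h (R \<union> u))"
    by (simp add: sum_Pow_binomial fR)
  finally show ?thesis using p by (simp add: sum_supergraphs[OF R])
qed

lemma pmf_erdos_renyi:
  assumes p: "0 \<le> p" "p \<le> 1" and g: "g \<subseteq> complete_graph n"
  shows "pmf (erdos_renyi n p) g = weight n p g"
proof -
  let ?K = "complete_graph n"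
  let ?M = "Pi_pmf ?K False (\<lambda>_. bernoulli_pmf p)"
  let ?f = "\<lambda>f. {e \<in> ?K. f e}"
  have "pmf (erdos_renyi n p) g = measure ?M (?f -` {g} \<inter> set_pmf ?M)"
    by (simp add: erdos_renyi_def pmf_map measure_Int_set_pmf)
  \<comment> \<open>On the support, the default value \<open>False\<close> is forced outside the
    complete graph, so only one function is left in the preimage.\<close>
  also have "?f -` {g} \<inter> set_pmf ?M = {\<lambda>e. e \<in> g} \<inter> set_pmf ?M"
  proof -
    have "f = (\<lambda>e. e \<in> g)" if "f \<in> set_pmf ?M" "?f f = g" for f
      using that set_Pi_pmf_subset[of ?K False "\<lambda>_. bernoulli_pmf p"] by fastforce
    thus ?thesis using g by auto
  qed
  also have "measure ?M \<dots> = pmf ?M (\<lambda>e. e \<in> g)"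
    by (simp add: measure_Int_set_pmf measure_pmf_single)
  also have "\<dots> = (\<Prod>e\<in>?K. if e \<in> g then p else 1 - p)"
    using g p by (subst pmf_Pi) (auto intro!: prod.cong)
  also have "\<dots> = weight n p g"
    using g finite_subset[OF g]
    by (simp add: prod.If_cases weight_def Int_absorb1 Diff_eq[symmetric] card_Diff_subset)
  finally show ?thesis .
qed

lemma expectation_erdos_renyi:
  assumes "0 \<le> p" "p \<le> 1"
  shows "measure_pmf.expectation (erdos_renyi n p) h = (\<Sum>g\<in>Pow (complete_graph n). weight n p g * h g)"
proof -
  have "set_pmf (erdos_renyi n p) \<subseteq> Pow (complete_graph n)" by (auto simp: erdos_renyi_def)
  hence "measure_pmf.expectation (erdos_renyi n p) h =
      (\<Sum>g\<in>Pow (complete_graph n). pmf (erdos_renyi n p) g *\<^sub>R h g)"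
    by (intro integral_measure_pmf) auto
  thus ?thesis by (simp add: pmf_erdos_renyi assms)
qed

section \<open>Permutations acting on graphs, and the uniform copy\<close>

lemma edge_image_comp: "edge_image (\<pi> \<circ> \<rho>) H = edge_image \<pi> (edge_image \<rho> H)"
  by (simp add: edge_image_def image_image image_comp)

lemma edge_image_id [simp]: "edge_image id H = H"
  by (simp add: edge_image_def)

lemma edge_image_Int: "inj \<pi> \<Longrightarrow> edge_image \<pi> (A \<inter> B) = edge_image \<pi> A \<inter> edge_image \<pi> B"
  unfolding edge_image_def by (rule image_Int) (simp add: inj_def inj_image_eq_iff)

lemma card_edge_image: "inj \<pi> \<Longrightarrow> card (edge_image \<pi> A) = card A"
  unfolding edge_image_def by (rule card_image) (auto simp: inj_on_def inj_image_eq_iff)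

lemma edge_image_in_copies: "\<pi> permutes {1..n} \<Longrightarrow> edge_image \<pi> H \<in> copies n H"
  by (auto simp: copies_def edge_image_def)

lemma copies_eq_image: "copies n H = (\<lambda>\<pi>. edge_image \<pi> H) ` {\<pi>. \<pi> permutes {1..n}}"
  by (auto simp: copies_def edge_image_def)

lemma edge_image_subset_complete:
  assumes "H \<subseteq> complete_graph n" "\<pi> permutes {1..n}"
  shows "edge_image \<pi> H \<subseteq> complete_graph n"
  using copies_subset(1)[OF assms(1) edge_image_in_copies[OF assms(2)]] .

text \<open>All fibres of \<open>\<pi> \<mapsto> \<pi> H\<close> are cosets of the stabiliser of \<open>H\<close>, so a uniform permutation
  induces the uniform distribution on copies.\<close>

lemma sum_over_copies:
  fixes h :: "graph \<Rightarrow> real"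
  shows "(\<Sum>K\<in>copies n H. h K) / real (card (copies n H)) =
    (\<Sum>\<pi> | \<pi> permutes {1..n}. h (edge_image \<pi> H)) / fact n"
proof -
  let ?P = "{\<pi>. \<pi> permutes {1..n}}"
  let ?F = "\<lambda>K. {\<pi> \<in> ?P. edge_image \<pi> H = K}"
  define m where "m = card (?F H)"
  have fP: "finite ?P" by (simp add: finite_permutations)
  have m: "card (?F K) = m" if K: "K \<in> copies n H" for K
  proof -
    obtain \<tau> where \<tau>: "\<tau> permutes {1..n}" "K = edge_image \<tau> H"
      using K by (auto simp: copies_eq_image)
    have "bij_betw (\<lambda>\<pi>. \<tau> \<circ> \<pi>) (?F H) (?F K)"
    proof (rule bij_betw_byWitness[where f' = "\<lambda>\<pi>. inv \<tau> \<circ> \<pi>"])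
      have 1: "inv \<tau> \<circ> (\<tau> \<circ> \<pi>) = \<pi>" "\<tau> \<circ> (inv \<tau> \<circ> \<pi>) = \<pi>" for \<pi> :: "nat \<Rightarrow> nat"
        by (simp_all add: fun_eq_iff permutes_inverses[OF \<tau>(1)])
      show "\<forall>a\<in>?F H. inv \<tau> \<circ> (\<tau> \<circ> a) = a" "\<forall>a'\<in>?F K. \<tau> \<circ> (inv \<tau> \<circ> a') = a'"
        using 1 by auto
      show "(\<lambda>\<pi>. \<tau> \<circ> \<pi>) ` ?F H \<subseteq> ?F K"
        using \<tau> by (auto simp: edge_image_comp intro: permutes_compose)
      have "edge_image (inv \<tau>) K = H"
        using \<tau> by (simp add: edge_image_comp[symmetric] permutes_inv_o)
      thus "(\<lambda>\<pi>. inv \<tau> \<circ> \<pi>) ` ?F K \<subseteq> ?F H"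
        using \<tau> by (auto simp: edge_image_comp intro: permutes_compose permutes_inv)
    qed
    thus ?thesis by (simp add: m_def bij_betw_same_card)
  qed
  have "(\<Sum>\<pi>\<in>?P. h' (edge_image \<pi> H)) = real m * (\<Sum>K\<in>copies n H. h' K)" for h' :: "graph \<Rightarrow> real"
  proof -
    have "(\<Sum>\<pi>\<in>?P. h' (edge_image \<pi> H)) = (\<Sum>K\<in>copies n H. \<Sum>\<pi>\<in>?F K. h' (edge_image \<pi> H))"
      unfolding copies_eq_image by (rule sum.image_gen[OF fP])
    also have "\<dots> = (\<Sum>K\<in>copies n H. \<Sum>\<pi>\<in>?F K. h' K)"
      by (intro sum.cong refl) auto
    also have "\<dots> = (\<Sum>K\<in>copies n H. real m * h' K)"
      by (intro sum.cong refl) (simp only: sum_constant m)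
    finally show ?thesis by (simp add: sum_distrib_left)
  qed
  note E = this
  \<comment> \<open>The unknown stabiliser size \<open>m\<close> is eliminated by the constant
    function 1: this is the orbit-stabiliser count.\<close>
  have "real m * real (card (copies n H)) = fact n"
    using E[of "\<lambda>_. 1"] card_permutations[of "{1..n}" n] by simp
  moreover have "card (copies n H) \<noteq> 0"
    using finite_copies copies_nonempty by simp
  ultimately show ?thesis unfolding E by (auto simp: field_simps)
qed

text \<open>Indexing by the observed graph instead of the noise makes the argument of the estimator
  a summation variable. After exchanging the sums, the single vector \<open>A g\<close> is compared
  with all copies inside \<open>g\<close>.\<close>

lemma mse_eq:
  assumes H: "H \<subseteq> complete_graph n" and p: "0 < p" "p \<le> 1"
  shows "mse n H p A = (\<Sum>\<pi> | \<pi> permutes {1..n}. \<Sum>g\<in>supergraphs n (edge_image \<pi> H).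
      weight n p g * sq_dist n (edge_image \<pi> H) (A g)) / (fact n * p ^ card H)"
proof -
  have "mse n H p A = measure_pmf.expectation (pmf_of_set (copies n H))
     (\<lambda>X. measure_pmf.expectation (erdos_renyi n p) (\<lambda>g. sq_dist n X (A (X \<union> g))))"
  proof -
    have "set_pmf (erdos_renyi n p) \<subseteq> Pow (complete_graph n)"
      by (auto simp: erdos_renyi_def)
    hence f: "finite (set_pmf (erdos_renyi n p))" by (rule finite_subset) simp
    have "pair_pmf (pmf_of_set (copies n H)) (erdos_renyi n p) =
      bind_pmf (pmf_of_set (copies n H)) (\<lambda>X. map_pmf (Pair X) (erdos_renyi n p))"
      by (simp add: pair_pmf_def map_pmf_def)
    hence "mse n H p A = (\<Sum>X\<in>set_pmf (pmf_of_set (copies n H)). pmf (pmf_of_set (copies n H)) X *\<^sub>R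
       measure_pmf.expectation (map_pmf (Pair X) (erdos_renyi n p))
         (\<lambda>\<omega>. \<Sum>e\<in>complete_graph n. (indicator (fst \<omega>) e - A (observed \<omega>) e)\<^sup>2))"
      unfolding mse_def planted_def
      by (simp only:, subst pmf_expectation_bind[OF _ _ subset_refl])
        (auto simp: finite_copies copies_nonempty f)
    also have "\<dots> = measure_pmf.expectation (pmf_of_set (copies n H))
     (\<lambda>X. measure_pmf.expectation (erdos_renyi n p) (\<lambda>g. sq_dist n X (A (X \<union> g))))"
      by (subst integral_measure_pmf[of "copies n H"])
        (auto simp: finite_copies copies_nonempty sq_dist_def observed_def)
    finally show ?thesis .
  qed
  also have "\<dots> = (\<Sum>X\<in>copies n H. measure_pmf.expectation (erdos_renyi n p)
      (\<lambda>g. sq_dist n X (A (X \<union> g)))) / real (card (copies n H))"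
    by (simp add: integral_pmf_of_set finite_copies copies_nonempty)
  also have "\<dots> = (\<Sum>\<pi> | \<pi> permutes {1..n}. measure_pmf.expectation (erdos_renyi n p)
      (\<lambda>g. sq_dist n (edge_image \<pi> H) (A (edge_image \<pi> H \<union> g)))) / fact n"
    by (rule sum_over_copies)
  also have "\<dots> = (\<Sum>\<pi> | \<pi> permutes {1..n}. (\<Sum>g\<in>supergraphs n (edge_image \<pi> H).
      weight n p g * sq_dist n (edge_image \<pi> H) (A g)) / p ^ card H) / fact n"
  proof (intro arg_cong2[where f = "(/)"] sum.cong refl)
    fix \<pi> assume "\<pi> \<in> {\<pi>. \<pi> permutes {1..n}}"
    hence \<pi>: "\<pi> permutes {1..n}" by simp
    show "measure_pmf.expectation (erdos_renyi n p)
      (\<lambda>g. sq_dist n (edge_image \<pi> H) (A (edge_image \<pi> H \<union> g))) =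
      (\<Sum>g\<in>supergraphs n (edge_image \<pi> H).
      weight n p g * sq_dist n (edge_image \<pi> H) (A g)) / p ^ card H"
      using sum_weight_union[OF edge_image_subset_complete[OF H \<pi>] p(1),
          of "\<lambda>g. sq_dist n (edge_image \<pi> H) (A g)"] p
      by (simp add: expectation_erdos_renyi card_edge_image permutes_inj[OF \<pi>])
  qed
  finally show ?thesis by (simp add: sum_divide_distrib mult.commute)
qed

section \<open>Overlaps and quadratic risk\<close>

text \<open>Collects indices, not graphs: several permutations may give the same copy and each has
  to count. The same notion later serves for pairs of copies and for pairs of a pattern with an
  extension.\<close>

definition contained :: "'i set \<Rightarrow> ('i \<Rightarrow> graph) \<Rightarrow> graph \<Rightarrow> 'i set" where
  "contained I X g = {i \<in> I. X i \<subseteq> g}"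

definition overlap_sum :: "'i set \<Rightarrow> ('i \<Rightarrow> graph) \<Rightarrow> real" where
  "overlap_sum I X = (\<Sum>i\<in>I. \<Sum>j\<in>I. real (card (X i \<inter> X j)))"

definition mean_indicator :: "'i set \<Rightarrow> ('i \<Rightarrow> graph) \<Rightarrow> nat set \<Rightarrow> real" where
  "mean_indicator I X e = (\<Sum>i\<in>I. indicator (X i) e) / real (card I)"

lemma finite_contained [simp]: "finite I \<Longrightarrow> finite (contained I X g)"
  by (simp add: contained_def)

text \<open>Decomposition into variance and squared bias, one edge at a time. The variance part
  becomes the overlap because the square of the number of members through \<open>e\<close> counts
  the pairs whose intersection contains \<open>e\<close>.\<close>

lemma sum_sq_dist:
  assumes I: "finite I" and X: "\<And>i. i \<in> I \<Longrightarrow> X i \<subseteq> complete_graph n" "\<And>i. i \<in> I \<Longrightarrow> card (X i) = k"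
  shows "(\<Sum>i\<in>I. sq_dist n (X i) a) = real (card I) * real k - overlap_sum I X / real (card I)
    + real (card I) * (\<Sum>e\<in>complete_graph n. (a e - mean_indicator I X e)\<^sup>2)"
proof (cases "I = {}")
  case True
  thus ?thesis by (simp add: overlap_sum_def)
next
  case False
  let ?K = "complete_graph n"
  let ?s = "\<lambda>e. (\<Sum>i\<in>I. indicator (X i) e) :: real"
  have m: "real (card I) > 0" using False I by (simp add: card_gt_0_iff)
  have ind: "(\<Sum>e\<in>?K. indicator Y e) = real (card Y)" if "Y \<subseteq> ?K" for Y :: graph
    using that by (simp add: indicator_def sum.If_cases Int_absorb1)
  have per: "(\<Sum>i\<in>I. (indicator (X i) e - a e)\<^sup>2) =
      ?s e - (?s e)\<^sup>2 / card I + card I * (a e - mean_indicator I X e)\<^sup>2" for e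
  proof -
    have "(\<Sum>i\<in>I. (indicator (X i) e - a e)\<^sup>2) =
        (\<Sum>i\<in>I. (1 - 2 * a e) * indicator (X i) e + (a e)\<^sup>2)"
      by (intro sum.cong) (auto simp: indicator_def power2_eq_square algebra_simps)
    also have "\<dots> = (1 - 2 * a e) * ?s e + card I * (a e)\<^sup>2"
      by (simp add: sum.distrib sum_distrib_left)
    also have "\<dots> = ?s e - (?s e)\<^sup>2 / card I + card I * (a e - mean_indicator I X e)\<^sup>2"
      using m by (simp add: mean_indicator_def power2_eq_square field_simps)
    finally show ?thesis .
  qed
  have s1: "(\<Sum>e\<in>?K. ?s e) = card I * real k"
    by (subst sum.swap) (simp add: ind X)
  have s2: "(\<Sum>e\<in>?K. (?s e)\<^sup>2) = overlap_sum I X"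
  proof -
    have "(\<Sum>e\<in>?K. (?s e)\<^sup>2) = (\<Sum>e\<in>?K. \<Sum>i\<in>I. \<Sum>j\<in>I. indicator (X i \<inter> X j) e)"
      by (simp add: power2_eq_square sum_product indicator_inter_arith)
    also have "\<dots> = (\<Sum>i\<in>I. \<Sum>e\<in>?K. \<Sum>j\<in>I. indicator (X i \<inter> X j) e)"
      by (rule sum.swap)
    also have "\<dots> = (\<Sum>i\<in>I. \<Sum>j\<in>I. \<Sum>e\<in>?K. indicator (X i \<inter> X j) e)"
      by (intro sum.cong refl sum.swap)
    also have "\<dots> = overlap_sum I X"
      unfolding overlap_sum_def by (intro sum.cong refl ind) (use X in auto)
    finally show ?thesis .
  qed
  have "(\<Sum>i\<in>I. sq_dist n (X i) a) = (\<Sum>e\<in>?K. \<Sum>i\<in>I. (indicator (X i) e - a e)\<^sup>2)"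
    unfolding sq_dist_def by (rule sum.swap)
  also have "\<dots> = (\<Sum>e\<in>?K. ?s e) - (\<Sum>e\<in>?K. (?s e)\<^sup>2) / card I
      + card I * (\<Sum>e\<in>?K. (a e - mean_indicator I X e)\<^sup>2)"
    by (simp add: per sum.distrib sum_subtractf sum_divide_distrib sum_distrib_left)
  finally show ?thesis by (simp add: s1 s2)
qed

lemma sum_sq_dist_ge:
  assumes "finite I" "\<And>i. i \<in> I \<Longrightarrow> X i \<subseteq> complete_graph n" "\<And>i. i \<in> I \<Longrightarrow> card (X i) = k"
  shows "(\<Sum>i\<in>I. sq_dist n (X i) a) \<ge> real (card I) * real k - overlap_sum I X / real (card I)"
  using sum_sq_dist[OF assms, where a = a] by (simp add: sum_nonneg)

lemma sum_sq_dist_mean: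
  assumes "finite I" "\<And>i. i \<in> I \<Longrightarrow> X i \<subseteq> complete_graph n" "\<And>i. i \<in> I \<Longrightarrow> card (X i) = k"
  shows "(\<Sum>i\<in>I. sq_dist n (X i) (mean_indicator I X)) =
    real (card I) * real k - overlap_sum I X / real (card I)"
  using sum_sq_dist[OF assms, where a = "mean_indicator I X"] by simp

lemma sum_supergraphs_swap:
  assumes "finite I" "\<And>i. i \<in> I \<Longrightarrow> X i \<subseteq> complete_graph n"
  shows "(\<Sum>i\<in>I. \<Sum>g\<in>supergraphs n (X i). f i g) =
    (\<Sum>g\<in>Pow (complete_graph n). \<Sum>i\<in>contained I X g. f i g)"
proof -
  have "supergraphs n (X i) = {g \<in> Pow (complete_graph n). X i \<subseteq> g}" for i
    by (auto simp: supergraphs_def)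
  thus ?thesis unfolding contained_def by (simp only:) (rule sum.swap_restrict, auto simp: assms)
qed

lemma sum_weight_contained:
  assumes "finite I" "\<And>i. i \<in> I \<Longrightarrow> X i \<subseteq> complete_graph n" "\<And>i. i \<in> I \<Longrightarrow> card (X i) = k"
  shows "(\<Sum>g\<in>Pow (complete_graph n). weight n p g * real (card (contained I X g))) =
    real (card I) * p ^ k"
proof -
  have "(\<Sum>g\<in>Pow (complete_graph n). weight n p g * real (card (contained I X g))) =
      (\<Sum>i\<in>I. \<Sum>g\<in>supergraphs n (X i). weight n p g)"
    by (subst sum_supergraphs_swap) (auto simp: assms mult.commute)
  thus ?thesis by (simp add: sum_weight_supergraphs assms)
qed

text \<open>Restricted second moment bound. The number \<open>N\<close> of members contained in \<open>g\<close> may be small, so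
  the number \<open>B\<close> of bad pairs among them enters through \<open>B / N \<le> sqrt B \<le> (y + B / y) / 2\<close>,
  with \<open>y\<close> of the order of the mean of \<open>N\<close> given \<open>S \<subseteq> g\<close>.\<close>

lemma averaged_risk_lower:
  fixes l \<eta> p :: real
  assumes I: "finite I" "I \<noteq> {}"
    and X: "\<And>i. i \<in> I \<Longrightarrow> X i \<subseteq> complete_graph n" "\<And>i. i \<in> I \<Longrightarrow> card (X i) = k"
    and S: "\<And>i. i \<in> I \<Longrightarrow> S \<subseteq> X i"
    and p: "0 < p" "p \<le> 1" and l: "0 \<le> l" and \<eta>: "0 < \<eta>"
    and M: "(\<Sum>(i, j)\<in>{(i, j)\<in>I \<times> I. l \<le> real (card (X i \<inter> X j))}.
        1 / p ^ (card (X i \<inter> X j) - card S)) \<le> \<eta>\<^sup>2 * (real (card I))\<^sup>2"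
  shows "(\<Sum>i\<in>I. \<Sum>g\<in>supergraphs n (X i). weight n p g * sq_dist n (X i) (A g)) \<ge>
    real (card I) * p ^ k * (k - l - k * \<eta>)"
proof -
  let ?K = "complete_graph n"
  define J where "J g = contained I X g" for g
  define B where "B g = {(i, j)\<in>J g \<times> J g. l \<le> real (card (X i \<inter> X j))}" for g
  define Z where "Z = {(i, j)\<in>I \<times> I. l \<le> real (card (X i \<inter> X j))}"
  define s where "s = card S"
  \<comment> \<open>The factor \<open>\<eta>\<close> balances the two halves of the bound on
    \<open>B / N\<close>: on average each is at most \<open>\<eta> * card I * p ^ k\<close>, see
    \<open>Y\<close> and \<open>Bs'\<close>.\<close>
  define y where "y = \<eta> * card I * p ^ (k - s)"
  obtain i0 where i0: "i0 \<in> I" using I by auto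
  have fX: "finite (X i)" if "i \<in> I" for i
    using X(1)[OF that] finite_complete_graph by (rule finite_subset)
  have sk: "s \<le> k" unfolding s_def using S[OF i0] X(2)[OF i0] fX[OF i0] by (metis card_mono)
  have SK: "S \<subseteq> ?K" using S[OF i0] X(1)[OF i0] by auto
  have cI: "real (card I) > 0" using I by (simp add: card_gt_0_iff)
  have y: "y > 0" using \<eta> cI p by (simp add: y_def)
  have fJ: "finite (J g)" for g using I by (simp add: J_def)
  have fZ: "finite Z" unfolding Z_def by (rule finite_subset[of _ "I \<times> I"]) (use I in auto)
  have fB: "finite (B g)" for g unfolding B_def by (rule finite_subset[of _ "J g \<times> J g"]) (use fJ in auto)
  have JX: "i \<in> J g \<Longrightarrow> i \<in> I \<and> X i \<subseteq> g" for i g by (auto simp: J_def contained_def)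
  \<comment> \<open>The term \<open>y\<close> is charged only to graphs containing \<open>S\<close>,
    as no member lies in any other graph. These have total weight \<open>p ^ s\<close>, which
    completes the \<open>p ^ (k - s)\<close> inside \<open>y\<close> to
    \<open>p ^ k\<close>.\<close>
  have per: "(\<Sum>i\<in>J g. sq_dist n (X i) (A g)) \<ge> real (card (J g)) * (k - l)
      - k * ((if S \<subseteq> g then y else 0) + card (B g) / y) / 2" for g
  proof (cases "J g = {}")
    case True
    have "0 \<le> k * ((if S \<subseteq> g then y else 0) + card (B g) / y) / 2" using y by simp
    thus ?thesis using True by simp
  next
    case False
    hence Sg: "S \<subseteq> g" using JX S by blast
    define N where "N = real (card (J g))"
    define b where "b = real (card (B g))"
    have N: "N > 0" using False fJ by (simp add: N_def card_gt_0_iff)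
    have "overlap_sum (J g) X = (\<Sum>(i, j)\<in>J g \<times> J g. real (card (X i \<inter> X j)))"
      by (simp add: overlap_sum_def sum.cartesian_product)
    also have "\<dots> \<le> (\<Sum>z\<in>J g \<times> J g. l + (if z \<in> B g then real k else 0))"
    proof (rule sum_mono, clarify)
      fix i j assume ij: "i \<in> J g" "j \<in> J g"
      have "card (X i \<inter> X j) \<le> k"
        using JX[OF ij(1)] fX X(2) card_mono[of "X i" "X i \<inter> X j"] by auto
      thus "real (card (X i \<inter> X j)) \<le> l + (if (i, j) \<in> B g then real k else 0)"
        using ij l by (auto simp: B_def)
    qed
    also have "\<dots> = N\<^sup>2 * l + k * b"
    proof -
      have "(\<Sum>z\<in>J g \<times> J g. if z \<in> B g then real k else 0) = (\<Sum>z\<in>B g. real k)"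
        by (rule sum.mono_neutral_cong_right) (use fJ in \<open>auto simp: B_def\<close>)
      thus ?thesis
        by (simp add: sum.distrib N_def b_def power2_eq_square card_cartesian_product)
    qed
    finally have ov: "overlap_sum (J g) X / N \<le> N * l + k * (b / N)"
      using N by (simp add: field_simps power2_eq_square)
    have bN: "b \<le> N\<^sup>2"
    proof -
      have "card (B g) \<le> card (J g \<times> J g)"
        using fJ by (intro card_mono) (auto simp: B_def)
      hence "real (card (B g)) \<le> real (card (J g) * card (J g))"
        by (simp only: card_cartesian_product of_nat_le_iff)
      thus ?thesis by (simp add: b_def N_def power2_eq_square)
    qed
    have "b / N \<le> (y + b / y) / 2"
    proof -
      have "(b / N)\<^sup>2 \<le> b"
        using bN N mult_left_mono[OF bN, of b] by (simp add: b_def power2_eq_square field_simps)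
      moreover have "0 \<le> (y - b / N)\<^sup>2" by simp
      ultimately have "2 * (b / N) * y \<le> y * y + b" by (simp add: power2_eq_square algebra_simps)
      thus ?thesis using y by (simp add: field_simps)
    qed
    hence "k * (b / N) \<le> k * ((y + b / y) / 2)" by (rule mult_left_mono) simp
    hence "N * k - overlap_sum (J g) X / N \<ge> N * (k - l) - k * (y + b / y) / 2"
      using ov by (simp only: right_diff_distrib times_divide_eq_right[symmetric])
    moreover have "(\<Sum>i\<in>J g. sq_dist n (X i) (A g)) \<ge> N * k - overlap_sum (J g) X / N"
      unfolding N_def by (rule sum_sq_dist_ge) (use fJ JX X in auto)
    ultimately show ?thesis using Sg by (simp add: N_def b_def)
  qed
  have W: "(\<Sum>g\<in>Pow ?K. weight n p g * real (card (J g))) = card I * p ^ k"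
    unfolding J_def by (rule sum_weight_contained) (use I X in auto)
  have Y: "(\<Sum>g\<in>Pow ?K. weight n p g * (if S \<subseteq> g then y else 0)) = \<eta> * card I * p ^ k"
  proof -
    have "(\<Sum>g\<in>Pow ?K. weight n p g * (if S \<subseteq> g then y else 0)) =
        (\<Sum>g\<in>supergraphs n S. weight n p g * y)"
      by (rule sum.mono_neutral_cong_right) (auto simp: supergraphs_def)
    also have "\<dots> = p ^ s * y"
      by (simp add: sum_distrib_right[symmetric] sum_weight_supergraphs[OF SK] s_def)
    also have "\<dots> = \<eta> * card I * (p ^ s * p ^ (k - s))" by (simp add: y_def)
    finally show ?thesis using sk by (simp add: power_add[symmetric])
  qed
  have Bs: "(\<Sum>g\<in>Pow ?K. weight n p g * card (B g)) \<le> y * (\<eta> * card I * p ^ k)"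
  proof -
    have Zsub: "i \<in> I \<and> j \<in> I" if "(i, j) \<in> Z" for i j using that by (auto simp: Z_def)
    have "B g = contained Z (\<lambda>(i, j). X i \<union> X j) g" for g
      by (auto simp: B_def Z_def contained_def J_def)
    hence "(\<Sum>g\<in>Pow ?K. weight n p g * card (B g)) =
        (\<Sum>g\<in>Pow ?K. \<Sum>z\<in>contained Z (\<lambda>(i, j). X i \<union> X j) g. weight n p g)"
      by (simp add: mult.commute)
    also have "\<dots> = (\<Sum>z\<in>Z. \<Sum>g\<in>supergraphs n ((\<lambda>(i, j). X i \<union> X j) z). weight n p g)"
      by (rule sum_supergraphs_swap[symmetric]) (use fZ X Zsub in auto)
    \<comment> \<open>A union has \<open>2 * k\<close> edges minus the overlap. Splitting off the
      part of the overlap beyond \<open>S\<close> isolates the quantity bounded by assumption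
      \<open>M\<close>.\<close>
    also have "\<dots> = (\<Sum>(i, j)\<in>Z. p ^ (k - s + k) * (1 / p ^ (card (X i \<inter> X j) - s)))"
    proof (rule sum.cong[OF refl], clarify)
      fix i j assume ij: "(i, j) \<in> Z"
      note f = fX[of i] fX[of j] X(2)[of i] X(2)[of j] S[of i] S[of j] X(1)[of i] X(1)[of j]
      have cu: "card (X i \<union> X j) + card (X i \<inter> X j) = k + k"
        using card_Un_Int[of "X i" "X j"] f Zsub[OF ij] by simp
      have "s \<le> card (X i \<inter> X j)" unfolding s_def
        using f Zsub[OF ij] by (intro card_mono) auto
      hence "card (X i \<union> X j) + (card (X i \<inter> X j) - s) = k - s + k" using cu sk by linarith
      hence "p ^ card (X i \<union> X j) * p ^ (card (X i \<inter> X j) - s) = p ^ (k - s + k)"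
        by (metis power_add)
      moreover have "(\<Sum>g\<in>supergraphs n (X i \<union> X j). weight n p g) = p ^ card (X i \<union> X j)"
        using f Zsub[OF ij] by (intro sum_weight_supergraphs) auto
      ultimately show "(\<Sum>g\<in>supergraphs n (X i \<union> X j). weight n p g) =
          p ^ (k - s + k) * (1 / p ^ (card (X i \<inter> X j) - s))"
        using p by (simp add: field_simps)
    qed
    also have "\<dots> = p ^ (k - s + k) * (\<Sum>(i, j)\<in>Z. 1 / p ^ (card (X i \<inter> X j) - s))"
      by (simp add: sum_distrib_left case_prod_unfold)
    also have "\<dots> \<le> p ^ (k - s + k) * (\<eta>\<^sup>2 * (real (card I))\<^sup>2)"
      using M p unfolding Z_def[symmetric] s_def[symmetric] by (intro mult_left_mono) auto
    also have "\<dots> = y * (\<eta> * card I * p ^ k)"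
      by (simp add: y_def power2_eq_square power_add)
    finally show ?thesis .
  qed
  have Bs': "(\<Sum>g\<in>Pow ?K. weight n p g * (card (B g) / y)) \<le> \<eta> * card I * p ^ k"
    using Bs y by (simp add: sum_divide_distrib[symmetric] pos_divide_le_eq mult.commute)
  have "real (card I) * p ^ k * (k - l - k * \<eta>) =
      (k - l) * (card I * p ^ k) - k * (\<eta> * card I * p ^ k + \<eta> * card I * p ^ k) / 2"
    by (simp add: algebra_simps)
  also have "\<dots> \<le> (k - l) * (\<Sum>g\<in>Pow ?K. weight n p g * real (card (J g)))
     - k * ((\<Sum>g\<in>Pow ?K. weight n p g * (if S \<subseteq> g then y else 0))
       + (\<Sum>g\<in>Pow ?K. weight n p g * (card (B g) / y))) / 2"
    unfolding W Y using Bs' by (intro diff_mono order_refl divide_right_mono mult_left_mono add_mono) auto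
  also have "\<dots> = (\<Sum>g\<in>Pow ?K. weight n p g * (real (card (J g)) * (k - l)
      - k * ((if S \<subseteq> g then y else 0) + card (B g) / y) / 2))"
    by (simp add: sum_distrib_left sum_subtractf sum.distrib right_diff_distrib distrib_left
        sum_divide_distrib add_divide_distrib mult_ac)
  also have "\<dots> \<le> (\<Sum>g\<in>Pow ?K. weight n p g * (\<Sum>i\<in>J g. sq_dist n (X i) (A g)))"
    using per p by (intro sum_mono mult_left_mono) (auto simp: weight_nonneg)
  also have "\<dots> = (\<Sum>i\<in>I. \<Sum>g\<in>supergraphs n (X i). weight n p g * sq_dist n (X i) (A g))"
    by (subst sum_supergraphs_swap) (auto simp: I X J_def sum_distrib_left)
  finally show ?thesis .
qed

text \<open>In the overlap sum, a member without a bad partner earns at least \<open>l\<close> from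
  every contained partner. A member with a bad partner is written off at the full cost
  \<open>k\<close>, and such events have relative weight at most \<open>\<beta>\<close>.\<close>

lemma averaged_risk_upper:
  fixes l \<beta> p :: real
  assumes I: "finite I"
    and X: "\<And>i. i \<in> I \<Longrightarrow> X i \<subseteq> complete_graph n" "\<And>i. i \<in> I \<Longrightarrow> card (X i) = k"
    and p: "0 < p" "p \<le> 1" and l: "l \<le> k"
    and bad: "\<And>i. i \<in> I \<Longrightarrow> (\<Sum>g | g \<in> supergraphs n (X i) \<and>
        (\<exists>j\<in>I. X j \<subseteq> g \<and> real (card (X i \<inter> X j)) < l). weight n p g) \<le> \<beta> * p ^ k"
  shows "(\<Sum>i\<in>I. \<Sum>g\<in>supergraphs n (X i). weight n p g *
      sq_dist n (X i) (mean_indicator (contained I X g) X)) \<le> real (card I) * p ^ k * (k - l + k * \<beta>)"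
proof -
  let ?K = "complete_graph n"
  define J where "J g = contained I X g" for g
  define b where "b i g \<longleftrightarrow> (\<exists>j\<in>I. X j \<subseteq> g \<and> real (card (X i \<inter> X j)) < l)" for i g
  have fJ: "finite (J g)" for g using I by (simp add: J_def)
  have JX: "i \<in> J g \<Longrightarrow> i \<in> I \<and> X i \<subseteq> g" for i g by (auto simp: J_def contained_def)
  have per: "(\<Sum>i\<in>J g. sq_dist n (X i) (mean_indicator (J g) X)) \<le>
      (\<Sum>i\<in>J g. k - l + k * of_bool (b i g))" for g
  proof (cases "J g = {}")
    case False
    define N where "N = real (card (J g))"
    have N: "N > 0" using False fJ by (simp add: N_def card_gt_0_iff)
    have "N * (\<Sum>i\<in>J g. l - k * of_bool (b i g)) = (\<Sum>i\<in>J g. N * (l - k * of_bool (b i g)))"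
      by (rule sum_distrib_left)
    also have "\<dots> \<le> overlap_sum (J g) X"
      unfolding overlap_sum_def
    proof (rule sum_mono)
      fix i assume i: "i \<in> J g"
      have "(\<Sum>j\<in>J g. l - k * of_bool (b i g)) \<le> (\<Sum>j\<in>J g. real (card (X i \<inter> X j)))"
      proof (rule sum_mono)
        fix j assume j: "j \<in> J g"
        show "l - k * of_bool (b i g) \<le> real (card (X i \<inter> X j))"
        proof (cases "b i g")
          case True
          thus ?thesis using l of_nat_0_le_iff[of "card (X i \<inter> X j)", where ?'a = real] by simp
        next
          case False
          thus ?thesis using JX[OF j] by (auto simp: b_def not_less)
        qed
      qed
      thus "N * (l - k * of_bool (b i g)) \<le> (\<Sum>j\<in>J g. real (card (X i \<inter> X j)))"
        by (simp add: N_def)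
    qed
    finally have "(\<Sum>i\<in>J g. l - k * of_bool (b i g)) \<le> overlap_sum (J g) X / N"
      using N by (simp add: field_simps)
    moreover have "(\<Sum>i\<in>J g. sq_dist n (X i) (mean_indicator (J g) X)) = N * k - overlap_sum (J g) X / N"
      unfolding N_def by (rule sum_sq_dist_mean) (use fJ JX X in auto)
    moreover have "(\<Sum>i\<in>J g. k - l + k * of_bool (b i g)) =
        N * k - (\<Sum>i\<in>J g. l - k * of_bool (b i g))"
      by (simp add: sum.distrib sum_subtractf N_def algebra_simps)
    ultimately show ?thesis by linarith
  qed simp
  have "(\<Sum>i\<in>I. \<Sum>g\<in>supergraphs n (X i). weight n p g * sq_dist n (X i) (mean_indicator (J g) X)) =
      (\<Sum>g\<in>Pow ?K. weight n p g * (\<Sum>i\<in>J g. sq_dist n (X i) (mean_indicator (J g) X)))"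
    by (subst sum_supergraphs_swap) (auto simp: I X J_def sum_distrib_left)
  also have "\<dots> \<le> (\<Sum>g\<in>Pow ?K. weight n p g * (\<Sum>i\<in>J g. k - l + k * of_bool (b i g)))"
    by (rule sum_mono, rule mult_left_mono[OF per]) (use p in \<open>simp add: weight_nonneg\<close>)
  also have "\<dots> = (\<Sum>i\<in>I. \<Sum>g\<in>supergraphs n (X i). weight n p g * (k - l + k * of_bool (b i g)))"
    by (subst sum_supergraphs_swap) (auto simp: I X J_def sum_distrib_left)
  also have "\<dots> \<le> (\<Sum>i\<in>I. p ^ k * (k - l + k * \<beta>))"
  proof (rule sum_mono)
    fix i assume i: "i \<in> I"
    have "(\<Sum>g\<in>supergraphs n (X i). weight n p g * of_bool (b i g)) =
        (\<Sum>g | g \<in> supergraphs n (X i) \<and> b i g. weight n p g)"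
      by (rule sum.mono_neutral_cong_right) auto
    also have "\<dots> \<le> \<beta> * p ^ k" using bad[OF i] by (simp add: b_def)
    finally have 1: "(\<Sum>g\<in>supergraphs n (X i). weight n p g * of_bool (b i g)) \<le> \<beta> * p ^ k" .
    have "(\<Sum>g\<in>supergraphs n (X i). weight n p g * (k - l + k * of_bool (b i g))) =
       (k - l) * (\<Sum>g\<in>supergraphs n (X i). weight n p g) +
       k * (\<Sum>g\<in>supergraphs n (X i). weight n p g * of_bool (b i g))"
      by (simp add: sum_distrib_left sum.distrib distrib_left mult_ac del: sum_mult_of_bool_eq sum_of_bool_mult_eq)
    also have "\<dots> \<le> (k - l) * p ^ k + k * (\<beta> * p ^ k)"
      using 1 by (simp add: sum_weight_supergraphs X[OF i] mult_left_mono)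
    finally show "(\<Sum>g\<in>supergraphs n (X i). weight n p g * (k - l + k * of_bool (b i g))) \<le>
      p ^ k * (k - l + k * \<beta>)" by (simp add: algebra_simps)
  qed
  finally show ?thesis by (simp add: J_def)
qed

text \<open>Frees the error from the infimum over estimators: what remains is a polynomial in
  \<open>p\<close> divided by \<open>p ^ card H\<close>, usable for continuity and for
  \<open>p = 1\<close>. Graphs without a copy contribute 0, by the convention
  \<open>x / 0 = 0\<close>.\<close>

lemma mmse_eq_overlap:
  assumes H: "H \<subseteq> complete_graph n" and p: "0 < p" "p \<le> 1"
  defines "P \<equiv> {\<pi>. \<pi> permutes {1..n}}" and "X \<equiv> \<lambda>\<pi>. edge_image \<pi> H"
  shows "mmse n H p = (\<Sum>g\<in>Pow (complete_graph n). weight n p g *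
     (real (card (contained P X g)) * real (card H)
       - overlap_sum (contained P X g) X / real (card (contained P X g))))
     / (fact n * p ^ card H) / real (card H)"
proof -
  have fP: "finite P" by (simp add: P_def finite_permutations)
  have X: "X \<pi> \<subseteq> complete_graph n" "card (X \<pi>) = card H" if "\<pi> \<in> P" for \<pi>
    using that edge_image_subset_complete[OF H] by (auto simp: P_def X_def card_edge_image permutes_inj)
  let ?J = "contained P X"
  let ?R = "\<lambda>g. real (card (?J g)) * real (card H) - overlap_sum (?J g) X / real (card (?J g))"
  have E: "mse n H p A = (\<Sum>g\<in>Pow (complete_graph n). weight n p g * (\<Sum>\<pi>\<in>?J g. sq_dist n (X \<pi>) (A g)))
      / (fact n * p ^ card H)" for A
  proof -
    have "mse n H p A = (\<Sum>\<pi>\<in>P. \<Sum>g\<in>supergraphs n (X \<pi>). weight n p g * sq_dist n (X \<pi>) (A g))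
        / (fact n * p ^ card H)"
      unfolding P_def X_def by (rule mse_eq[OF H p])
    also have "(\<Sum>\<pi>\<in>P. \<Sum>g\<in>supergraphs n (X \<pi>). weight n p g * sq_dist n (X \<pi>) (A g)) =
        (\<Sum>g\<in>Pow (complete_graph n). \<Sum>\<pi>\<in>?J g. weight n p g * sq_dist n (X \<pi>) (A g))"
      by (rule sum_supergraphs_swap) (use fP X in auto)
    finally show ?thesis by (simp only: sum_distrib_left)
  qed
  have JX: "i \<in> ?J g \<Longrightarrow> i \<in> P" for i g by (auto simp: contained_def)
  let ?F = "(\<Sum>g\<in>Pow (complete_graph n). weight n p g * ?R g) / (fact n * p ^ card H)"
  have "(INF A. mse n H p A) = ?F"
  proof (rule cInf_eq_minimum)
    have "mse n H p (\<lambda>g. mean_indicator (?J g) X) = ?F"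
      unfolding E by (subst sum_sq_dist_mean) (use fP X JX in auto)
    thus "?F \<in> range (mse n H p)" by (metis rangeI)
    fix x assume "x \<in> range (mse n H p)"
    then obtain A where x: "x = mse n H p A" by auto
    show "?F \<le> x" unfolding x E
      by (intro divide_right_mono sum_mono mult_left_mono sum_sq_dist_ge)
        (use fP X JX p in \<open>auto simp: weight_nonneg\<close>)
  qed
  thus ?thesis by (simp add: mmse_def)
qed

section \<open>Lower bound above the threshold\<close>

text \<open>Sampling without replacement: once \<open>U\<close> has been sent into \<open>W\<close>,
  a further point hits \<open>W\<close> with conditional probability
  \<open>(card W - card U) / (card B - card U)\<close>, which is at most \<open>r\<close>.\<close>

lemma card_permutes_into:
  fixes r :: real
  assumes B: "finite B" and U: "U \<subseteq> B" and W: "W \<subseteq> B"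
    and r: "0 \<le> r" "r \<le> 1" "real (card W) \<le> r * real (card B)"
  shows "real (card {\<gamma>. \<gamma> permutes B \<and> \<gamma> ` U \<subseteq> W}) \<le> r ^ card U * fact (card B)"
proof -
  have "finite U" using U B by (rule finite_subset)
  thus ?thesis using U
  proof (induction U rule: finite_induct)
    case empty
    show ?case using card_permutations[OF refl B] by simp
  next
    case (insert x U)
    define A where "A = {\<gamma>. \<gamma> permutes B \<and> \<gamma> ` U \<subseteq> W}"
    define A' where "A' y = {\<gamma> \<in> A. \<gamma> y \<in> W}" for y
    have fA: "finite A"
      unfolding A_def by (rule finite_subset[OF _ finite_permutations[OF B]]) auto
    \<comment> \<open>Points outside \<open>U\<close> are exchangeable: composing with a
      transposition swaps the roles of \<open>x\<close> and \<open>y\<close> and leaves the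
      condition on \<open>U\<close> alone. Double counting the pairs of a permutation and a point
      then gives \<open>dc\<close>.\<close>
    have eq: "card (A' y) = card (A' x)" if y: "y \<in> B - U" for y
    proof (rule bij_betw_same_card[of "\<lambda>\<gamma>. \<gamma> \<circ> Transposition.transpose x y"])
      have t: "Transposition.transpose x y permutes B" using y insert.prems by (intro permutes_swap_id) auto
      have fixU: "Transposition.transpose x y z = z" if "z \<in> U" for z
        using that y insert.hyps by (auto simp: Transposition.transpose_def)
      have inv: "(\<gamma> \<circ> Transposition.transpose x y) \<circ> Transposition.transpose x y = \<gamma>" for \<gamma> :: "'a \<Rightarrow> 'a"
        by (simp add: fun_eq_iff)
      have into: "\<gamma> \<circ> Transposition.transpose x y \<in> A" if "\<gamma> \<in> A" for \<gamma>
        using that t fixU by (auto simp: A_def intro: permutes_compose)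
      show "bij_betw (\<lambda>\<gamma>. \<gamma> \<circ> Transposition.transpose x y) (A' y) (A' x)"
      proof (rule bij_betw_byWitness[where f' = "\<lambda>\<gamma>. \<gamma> \<circ> Transposition.transpose x y"])
        have "\<gamma> \<circ> Transposition.transpose x y \<in> A' x" if "\<gamma> \<in> A' y" for \<gamma>
        proof -
          have "(\<gamma> \<circ> Transposition.transpose x y) x = \<gamma> y" by simp
          moreover have "\<gamma> \<in> A" "\<gamma> y \<in> W" using that unfolding A'_def by blast+
          ultimately show ?thesis using into[of \<gamma>] unfolding A'_def mem_Collect_eq by metis
        qed
        thus "(\<lambda>\<gamma>. \<gamma> \<circ> Transposition.transpose x y) ` A' y \<subseteq> A' x" by blast
        have "\<gamma> \<circ> Transposition.transpose x y \<in> A' y" if "\<gamma> \<in> A' x" for \<gamma>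
        proof -
          have "(\<gamma> \<circ> Transposition.transpose x y) y = \<gamma> x" by simp
          moreover have "\<gamma> \<in> A" "\<gamma> x \<in> W" using that unfolding A'_def by blast+
          ultimately show ?thesis using into[of \<gamma>] unfolding A'_def mem_Collect_eq by metis
        qed
        thus "(\<lambda>\<gamma>. \<gamma> \<circ> Transposition.transpose x y) ` A' x \<subseteq> A' y" by blast
      qed (unfold inv, rule ballI, rule refl, rule ballI, rule refl)
    qed
    have m: "card {y \<in> B - U. \<gamma> y \<in> W} + card U = card W" if \<gamma>: "\<gamma> \<in> A" for \<gamma>
    proof -
      have \<gamma>p: "\<gamma> permutes B" and \<gamma>U: "\<gamma> ` U \<subseteq> W" using \<gamma> by (auto simp: A_def)
      have fU: "finite U" by (rule insert.hyps)
      have "bij_betw \<gamma> {y \<in> B. \<gamma> y \<in> W} W"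
        unfolding bij_betw_def
      proof
        show "inj_on \<gamma> {y \<in> B. \<gamma> y \<in> W}" using permutes_inj[OF \<gamma>p] by (rule inj_on_subset) simp
        show "\<gamma> ` {y \<in> B. \<gamma> y \<in> W} = W"
        proof
          show "W \<subseteq> \<gamma> ` {y \<in> B. \<gamma> y \<in> W}"
          proof
            fix w assume w: "w \<in> W"
            hence "w \<in> \<gamma> ` B" unfolding permutes_image[OF \<gamma>p] using W by (rule subsetD[rotated])
            then obtain y where "y \<in> B" "\<gamma> y = w" by (elim imageE) simp
            thus "w \<in> \<gamma> ` {y \<in> B. \<gamma> y \<in> W}" using w by auto
          qed
        qed auto
      qed
      hence "card {y \<in> B. \<gamma> y \<in> W} = card W" by (rule bij_betw_same_card)
      moreover have "{y \<in> B. \<gamma> y \<in> W} = {y \<in> B - U. \<gamma> y \<in> W} \<union> U"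
        using insert.prems \<gamma>U by auto
      moreover have "card ({y \<in> B - U. \<gamma> y \<in> W} \<union> U) = card {y \<in> B - U. \<gamma> y \<in> W} + card U"
        using B fU by (intro card_Un_disjoint) auto
      ultimately show ?thesis by simp
    qed
    have "card (B - U) * card (A' x) = (\<Sum>y\<in>B - U. card (A' y))" by (simp add: eq)
    also have "\<dots> = (\<Sum>y\<in>B - U. \<Sum>\<gamma> | \<gamma> \<in> A \<and> \<gamma> y \<in> W. 1)" by (simp add: A'_def)
    also have "\<dots> = (\<Sum>\<gamma>\<in>A. \<Sum>y | y \<in> B - U \<and> \<gamma> y \<in> W. 1)"
      by (rule sum.swap_restrict) (use B fA in auto)
    also have "\<dots> = (\<Sum>\<gamma>\<in>A. card {y \<in> B - U. \<gamma> y \<in> W})" by simp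
    finally have "real (card (B - U) * card (A' x)) = real (\<Sum>\<gamma>\<in>A. card {y \<in> B - U. \<gamma> y \<in> W})"
      by (rule arg_cong)
    also have "\<dots> = (\<Sum>\<gamma>\<in>A. real (card W) - real (card U))"
      unfolding of_nat_sum by (rule sum.cong[OF refl]) (use m in fastforce)
    finally have dc: "real (card (B - U)) * card (A' x) = (real (card W) - real (card U)) * card A"
      by (simp add: mult.commute)
    have xBU: "x \<in> B - U" using insert by auto
    hence pos: "real (card (B - U)) > 0" using B by (auto simp: card_gt_0_iff)
    have cBU: "real (card (B - U)) = real (card B) - real (card U)"
      using insert B by (simp add: card_Diff_subset card_mono of_nat_diff)
    \<comment> \<open>Here \<open>r \<le> 1\<close> enters: removing \<open>card U\<close> from both
      the targets and the available points does not push the ratio above \<open>r\<close>.\<close>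
    have "real (card U) \<ge> r * real (card U)" using r by (simp add: mult_left_le_one_le)
    hence "real (card W) - real (card U) \<le> r * real (card (B - U))"
      using r unfolding cBU by (simp add: right_diff_distrib)
    hence "real (card (B - U)) * card (A' x) \<le> r * real (card (B - U)) * card A"
      unfolding dc by (rule mult_right_mono) simp
    hence "real (card (A' x)) \<le> r * card A" using pos by simp
    also have "\<dots> \<le> r * (r ^ card U * fact (card B))"
      using insert r unfolding A_def by (intro mult_left_mono) auto
    also have "{\<gamma>. \<gamma> permutes B \<and> \<gamma> ` insert x U \<subseteq> W} = A' x"
      by (auto simp: A'_def A_def)
    ultimately show ?case using insert by simp
  qed
qed

lemma vertices_mono: "A \<subseteq> B \<Longrightarrow> vertices A \<subseteq> vertices B"
  by (auto simp: vertices_def)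

lemma vertices_subset: "H \<subseteq> complete_graph n \<Longrightarrow> vertices H \<subseteq> {1..n}"
  by (auto simp: vertices_def complete_graph_def nsets_def)

lemma vertices_edge_image: "vertices (edge_image \<pi> A) = \<pi> ` vertices A"
  by (auto simp: vertices_def edge_image_def)

section \<open>The threshold as a min-max\<close>

lemma finite_threshold_sets:
  assumes "finite H"
  shows "finite {S. S \<subseteq> H \<and> real (card S) \<le> q * real (card H)}" "finite {J. J \<subseteq> H \<and> S \<subset> J}"
  using assms by (auto intro: finite_subset[of _ "Pow H"])

lemma threshold_sets_nonempty:
  assumes "finite H" "H \<noteq> {}" "q < 1" "S \<subseteq> H" "real (card S) \<le> q * real (card H)"
  shows "H \<in> {J. J \<subseteq> H \<and> S \<subset> J}"
proof -
  have "card H > 0" using assms by (simp add: card_gt_0_iff)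
  hence "q * real (card H) < card H" using assms(3) by simp
  hence "S \<noteq> H" using assms(5) by auto
  thus ?thesis using assms by auto
qed

text \<open>This lemma and \<open>expectation_threshold_le\<close> are the two readings of the
  min-max. The lower bound on the error needs one \<open>S\<close> that controls all its
  \<open>J\<close>; the upper bound needs, for each admissible \<open>S\<close>, some
  \<open>J\<close> reaching the threshold.\<close>

lemma expectation_threshold_attained:
  assumes H: "finite H" "H \<noteq> {}" and q: "0 \<le> q" "q < 1"
  obtains S where "S \<subseteq> H" "real (card S) \<le> q * real (card H)"
    "\<And>J. J \<subseteq> H \<Longrightarrow> S \<subset> J \<Longrightarrow>
      real n powr (- (real (card (vertices J - vertices S)) / real (card (J - S))))
        \<le> expectation_threshold q n H"
proof -
  let ?\<S> = "{S. S \<subseteq> H \<and> real (card S) \<le> q * real (card H)}"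
  let ?f = "\<lambda>S J. real n powr (- (real (card (vertices J - vertices S)) / real (card (J - S))))"
  let ?F = "\<lambda>S. MAX J\<in>{J. J \<subseteq> H \<and> S \<subset> J}. ?f S J"
  have "{} \<in> ?\<S>" using q by simp
  hence "Min (?F ` ?\<S>) \<in> ?F ` ?\<S>"
    using finite_threshold_sets(1)[OF H(1), of q] by (intro Min_in) blast+
  then obtain S where S: "S \<in> ?\<S>" "expectation_threshold q n H = ?F S"
    unfolding expectation_threshold_def by auto
  show ?thesis
  proof (rule that)
    show "S \<subseteq> H" "real (card S) \<le> q * real (card H)" using S by auto
    fix J assume "J \<subseteq> H" "S \<subset> J"
    thus "?f S J \<le> expectation_threshold q n H"
      unfolding S(2) by (intro Max_ge finite_imageI finite_threshold_sets(2) H(1)) auto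
  qed
qed

lemma expectation_threshold_le:
  assumes H: "finite H" "H \<noteq> {}" and q: "q < 1"
    and S: "S \<subseteq> H" "real (card S) \<le> q * real (card H)"
  obtains J where "J \<subseteq> H" "S \<subset> J" "expectation_threshold q n H \<le>
      real n powr (- (real (card (vertices J - vertices S)) / real (card (J - S))))"
proof -
  let ?\<S> = "{S. S \<subseteq> H \<and> real (card S) \<le> q * real (card H)}"
  let ?f = "\<lambda>S J. real n powr (- (real (card (vertices J - vertices S)) / real (card (J - S))))"
  let ?F = "\<lambda>S. MAX J\<in>{J. J \<subseteq> H \<and> S \<subset> J}. ?f S J"
  have "?F S \<in> ?f S ` {J. J \<subseteq> H \<and> S \<subset> J}"
    using finite_threshold_sets(2)[OF H(1), of S] threshold_sets_nonempty[OF H q S]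
    by (intro Max_in) blast+
  then obtain J where J: "J \<subseteq> H" "S \<subset> J" "?F S = ?f S J" by auto
  have "expectation_threshold q n H \<le> ?F S"
    unfolding expectation_threshold_def
    using finite_threshold_sets(1)[OF H(1), of q] S by (intro Min_le) auto
  thus ?thesis using J that by metis
qed

text \<open>With \<open>j\<close> new edges and \<open>m\<close> new vertices, raising to the power
  \<open>j\<close> clears the fractional exponent and turns the threshold condition into a
  comparison of \<open>p ^ j\<close> with \<open>n ^ m\<close>, the number of maps of the new
  vertices into \<open>{1..n}\<close>.\<close>

lemma powr_minus_ratio_power:
  assumes "0 < n" "0 < j"
  shows "(real n powr (- (real m / real j))) ^ j = 1 / real n ^ m"
proof -
  have "(real n powr (- (real m / real j))) ^ j = real n powr (- (real m / real j) * real j)"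
    using assms by (subst powr_powr[symmetric]) (simp add: powr_realpow)
  also have "- (real m / real j) * real j = - real m" using assms by simp
  also have "real n powr (- real m) = 1 / real n ^ m"
    using assms by (simp add: powr_minus powr_realpow divide_inverse)
  finally show ?thesis .
qed

lemma sum_Pow_power_card:
  fixes r :: real
  assumes "finite A"
  shows "(\<Sum>u\<in>Pow A. r ^ card u) = (r + 1) ^ card A"
  using prod_add[OF assms, of "\<lambda>_. r" "\<lambda>_. 1"] by simp

lemma sum_permutations_compose_left:
  assumes "q permutes S"
  shows "sum f {p. p permutes S} = sum (\<lambda>p. f (q \<circ> p)) {p. p permutes S}"
  by (rule sum.reindex_bij_witness[of _ "\<lambda>p. q \<circ> p" "\<lambda>p. inv q \<circ> p"])
    (use assms in \<open>auto simp: o_assoc permutes_inv_o permutes_compose permutes_inv\<close>)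

text \<open>Permutations factor as \<open>\<pi> \<circ> \<gamma>\<close> with \<open>\<gamma>\<close> fixing the vertices of the minimiser \<open>S\<close>; averaging over
  \<open>\<gamma>\<close> for fixed \<open>\<pi>\<close> amounts to revealing the image of \<open>S\<close>.\<close>

lemma mmse_lower_bound:
  assumes H: "H \<subseteq> complete_graph n" "H \<noteq> {}" and q: "0 \<le> q" "q < 1"
    and p: "0 < p" "p \<le> 1" and \<epsilon>: "0 < \<epsilon>" and \<delta>: "0 < \<delta>"
    and thr: "(1 + \<epsilon>) * expectation_threshold q n H \<le> p"
  defines "k \<equiv> real (card H)" and "v \<equiv> card (vertices H)"
  shows "mmse n H p \<ge> 1 - q - \<delta> - sqrt ((real v + 1) ^ v * (1 + \<epsilon>) powr (- \<delta> * k))"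
proof -
  have fH: "finite H" using H(1) finite_complete_graph by (rule finite_subset)
  have k: "k > 0" using fH H(2) by (simp add: k_def card_gt_0_iff)
  have VH: "vertices H \<subseteq> {1..n}" by (rule vertices_subset[OF H(1)])
  have fV: "finite (vertices H)" using VH by (rule finite_subset) simp
  obtain S where S: "S \<subseteq> H" "real (card S) \<le> q * k"
    and SJ: "\<And>J. J \<subseteq> H \<Longrightarrow> S \<subset> J \<Longrightarrow>
      real n powr (- (real (card (vertices J - vertices S)) / real (card (J - S))))
        \<le> expectation_threshold q n H"
    using expectation_threshold_attained[OF fH H(2) q, of n] unfolding k_def by metis
  define B where "B = {1..n} - vertices S"
  define W where "W = vertices H - vertices S"
  define \<Gamma> where "\<Gamma> = {\<gamma>. \<gamma> permutes B}"
  define C where "C = (1 + \<epsilon>) powr (- \<delta> * k)"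
  \<comment> \<open>As \<open>S\<close> has at most \<open>q * k\<close> edges, an overlap of at
    least \<open>l\<close> contains \<open>\<delta> * k\<close> edges outside \<open>S\<close>;
    these produce the decay \<open>C\<close>.\<close>
  define l where "l = (q + \<delta>) * k"
  define \<eta> where "\<eta> = sqrt ((real v + 1) ^ v * C)"
  have fB: "finite B" by (simp add: B_def)
  have VS: "vertices S \<subseteq> vertices H" using S(1) by (rule vertices_mono)
  have fVS: "finite (vertices S)" using VS fV by (rule finite_subset)
  have f\<Gamma>: "finite \<Gamma>" "\<Gamma> \<noteq> {}"
    using finite_permutations[OF fB] permutes_id[of B] unfolding \<Gamma>_def by blast+
  have c\<Gamma>: "real (card \<Gamma>) = fact (card B)" using card_permutations[OF refl fB] by (simp add: \<Gamma>_def)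
  have C: "C > 0" using \<epsilon> by (simp add: C_def)
  have \<eta>: "\<eta> > 0" "\<eta>\<^sup>2 = (real v + 1) ^ v * C"
    using C by (auto simp: \<eta>_def)
  obtain e where e: "e \<in> H" using H(2) by auto
  have n: "n > 0"
  proof (rule ccontr)
    assume "\<not> n > 0"
    thus False using e H(1) by (auto simp: complete_graph_def nsets_def)
  qed
  have vn: "v \<le> n" unfolding v_def using card_mono[OF _ VH] by simp
  have \<Gamma>n: "\<gamma> permutes {1..n}" if "\<gamma> \<in> \<Gamma>" for \<gamma>
    using that by (auto simp: \<Gamma>_def B_def intro: permutes_subset)
  have fixS: "edge_image \<gamma> S = S" if "\<gamma> \<in> \<Gamma>" for \<gamma>
  proof -
    have "\<gamma> x = x" if "x \<in> f" "f \<in> S" for x f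
      using that \<open>\<gamma> \<in> \<Gamma>\<close> by (auto simp: \<Gamma>_def B_def vertices_def intro!: permutes_not_in)
    hence "\<gamma> ` f = f" if "f \<in> S" for f using that by force
    thus ?thesis by (simp add: edge_image_def)
  qed
  let ?bad = "\<lambda>\<gamma>. l \<le> real (card (edge_image \<gamma> H \<inter> H))"
  let ?F = "\<lambda>m. if l \<le> real m then 1 / p ^ (m - card S) else 0"
  \<comment> \<open>Of the overlap only the vertex set \<open>U\<close> is remembered. Summing over
    the possible \<open>U\<close> is affordable, whereas a sum over edge sets \<open>J\<close> could
    outweigh \<open>C\<close>.\<close>
  have single: "?F (card (edge_image \<gamma> H \<inter> H)) \<le>
      (\<Sum>U | U \<in> Pow W \<and> \<gamma> ` U \<subseteq> W. real n ^ card U * C)" if \<gamma>: "\<gamma> \<in> \<Gamma>" for \<gamma>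
  proof (cases "?bad \<gamma>")
    case False
    thus ?thesis using C by (auto intro!: sum_nonneg)
  next
    case True
    have inj: "inj \<gamma>" using permutes_inj[OF \<Gamma>n[OF \<gamma>]] .
    define J where "J = {e \<in> H. \<gamma> ` e \<in> H}"
    have JH: "J \<subseteq> H" by (auto simp: J_def)
    have "edge_image \<gamma> J = edge_image \<gamma> H \<inter> H" by (auto simp: J_def edge_image_def)
    hence cJ: "card (edge_image \<gamma> H \<inter> H) = card J" using card_edge_image[OF inj, of J] by simp
    have "\<gamma> ` e \<in> H" if "e \<in> S" for e
      using that fixS[OF \<gamma>] S(1) by (auto simp: edge_image_def)
    hence SsubJ: "S \<subseteq> J" using S(1) by (auto simp: J_def)
    have fJ: "finite J" using JH fH by (rule finite_subset)
    define j where "j = card (J - S)"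
    have j: "card J - card S = j"
      using SsubJ fJ by (simp add: j_def card_Diff_subset finite_subset)
    have "real (card J) = real j + real (card S)"
      using j card_mono[OF fJ SsubJ] by linarith
    hence jk: "real j \<ge> \<delta> * k" using True S(2) unfolding cJ l_def by (simp add: algebra_simps)
    moreover have "\<delta> * k > 0" using \<delta> k by simp
    ultimately have j0: "j > 0" by linarith
    hence "S \<subset> J" using SsubJ by (auto simp: j_def)
    define U where "U = vertices J - vertices S"
    have UW: "U \<subseteq> W" using vertices_mono[OF JH] by (auto simp: U_def W_def)
    have "\<gamma> ` U \<subseteq> W"
    proof
      fix y assume "y \<in> \<gamma> ` U"
      then obtain x where x: "x \<in> vertices J" "x \<notin> vertices S" "y = \<gamma> x" by (auto simp: U_def)
      obtain e where "e \<in> J" "x \<in> e" using x(1) by (auto simp: vertices_def)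
      hence "y \<in> \<gamma> ` e" "\<gamma> ` e \<in> H" using x(3) by (auto simp: J_def)
      hence "y \<in> vertices H" unfolding vertices_def by blast
      moreover have "x \<in> B" using x VH vertices_mono[OF JH] by (auto simp: B_def)
      hence "y \<in> B" using \<gamma> x(3) by (simp add: \<Gamma>_def permutes_in_image)
      ultimately show "y \<in> W" by (auto simp: W_def B_def)
    qed
    have "1 / p ^ j \<le> real n ^ card U * C"
    proof -
      have "(1 + \<epsilon>) * real n powr (- (real (card U) / real j)) \<le> p"
        using SJ[OF JH \<open>S \<subset> J\<close>] thr \<epsilon> unfolding U_def j_def
        by (meson add_nonneg_nonneg less_imp_le mult_left_mono order_trans zero_le_one)
      hence "((1 + \<epsilon>) * real n powr (- (real (card U) / real j))) ^ j \<le> p ^ j"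
        using \<epsilon> by (intro power_mono) auto
      hence "(1 + \<epsilon>) ^ j / real n ^ card U \<le> p ^ j"
        using powr_minus_ratio_power[OF n j0, of "card U"] by (simp add: power_mult_distrib)
      hence "inverse (p ^ j) \<le> inverse ((1 + \<epsilon>) ^ j / real n ^ card U)"
        using \<epsilon> n by (intro le_imp_inverse_le) auto
      hence "1 / p ^ j \<le> real n ^ card U / (1 + \<epsilon>) ^ j"
        by (simp add: inverse_eq_divide)
      also have "\<dots> = real n ^ card U * (1 + \<epsilon>) powr (- real j)"
        using \<epsilon> by (simp add: powr_minus powr_realpow divide_inverse)
      also have "\<dots> \<le> real n ^ card U * C"
        unfolding C_def using \<epsilon> jk by (intro mult_left_mono powr_mono) auto
      finally show ?thesis .
    qed
    also have "\<dots> = (\<Sum>U\<in>{U}. real n ^ card U * C)" by simp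
    also have "\<dots> \<le> (\<Sum>U | U \<in> Pow W \<and> \<gamma> ` U \<subseteq> W. real n ^ card U * C)"
      using UW \<open>\<gamma> ` U \<subseteq> W\<close> fV C
      by (intro sum_mono2) (auto simp: W_def)
    finally show ?thesis using True by (simp add: cJ j)
  qed
  have sumF: "(\<Sum>\<gamma>\<in>\<Gamma>. ?F (card (edge_image \<gamma> H \<inter> H))) \<le> \<eta>\<^sup>2 * card \<Gamma>"
  proof -
    have cW: "real (card W) = real v - real (card (vertices S))"
      using VS fVS fV by (simp add: W_def v_def card_Diff_subset card_mono of_nat_diff)
    have cB: "real (card B) = real n - real (card (vertices S))"
      using VS VH fVS card_mono[of "{1..n}" "vertices S"]
      by (simp add: B_def card_Diff_subset of_nat_diff)
    \<comment> \<open>Removing the vertices of \<open>S\<close> from both \<open>vertices H\<close>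
      and \<open>{1..n}\<close> can only lower the ratio \<open>v / n\<close>, because
      \<open>v \<le> n\<close>.\<close>
    have "real v / real n * real (card (vertices S)) \<le> real (card (vertices S))"
      using vn n by (intro mult_left_le_one_le) auto
    hence r: "real (card W) \<le> real v / real n * real (card B)"
      unfolding cW cB right_diff_distrib using n by simp
    have WB: "W \<subseteq> B" using VH by (auto simp: W_def B_def)
    have "(\<Sum>\<gamma>\<in>\<Gamma>. ?F (card (edge_image \<gamma> H \<inter> H))) \<le>
        (\<Sum>\<gamma>\<in>\<Gamma>. \<Sum>U | U \<in> Pow W \<and> \<gamma> ` U \<subseteq> W. real n ^ card U * C)"
      by (rule sum_mono[OF single])
    also have "\<dots> = (\<Sum>U\<in>Pow W. \<Sum>\<gamma> | \<gamma> \<in> \<Gamma> \<and> \<gamma> ` U \<subseteq> W. real n ^ card U * C)"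
      by (rule sum.swap_restrict) (use f\<Gamma> fV in \<open>auto simp: W_def\<close>)
    also have "\<dots> = (\<Sum>U\<in>Pow W. real (card {\<gamma>. \<gamma> permutes B \<and> \<gamma> ` U \<subseteq> W}) * (real n ^ card U * C))"
      by (simp add: \<Gamma>_def)
    also have "\<dots> \<le> (\<Sum>U\<in>Pow W. (real v / real n) ^ card U * fact (card B) * (real n ^ card U * C))"
      using vn n r WB C fB by (intro sum_mono mult_right_mono card_permutes_into) auto
    \<comment> \<open>The powers of \<open>n\<close> cancel: the cost \<open>n ^ card U\<close>
      allowed by the threshold meets the chance \<open>(v / n) ^ card U\<close> of sending
      \<open>U\<close> into \<open>W\<close>. The remaining sum of \<open>v ^ card U\<close> is
      where the base \<open>v + 1\<close> comes from.\<close>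
    also have "\<dots> = (\<Sum>U\<in>Pow W. real v ^ card U) * (C * card \<Gamma>)"
      unfolding c\<Gamma> sum_distrib_right using n
      by (intro sum.cong) (simp_all add: power_divide)
    also have "\<dots> = (real v + 1) ^ card W * (C * card \<Gamma>)"
      using fV by (subst sum_Pow_power_card) (auto simp: W_def)
    also have "\<dots> \<le> (real v + 1) ^ v * (C * card \<Gamma>)"
      using C fV by (intro mult_right_mono power_increasing) (auto simp: v_def W_def intro!: card_mono)
    finally show ?thesis by (simp add: \<eta>)
  qed
  \<comment> \<open>\<open>A\<close> is arbitrary for each \<open>\<pi>\<close>, so this bound also
    covers an estimator that has been told the image of \<open>S\<close>.\<close>
  have cls: "(\<Sum>\<gamma>\<in>\<Gamma>. \<Sum>g\<in>supergraphs n (edge_image (\<pi> \<circ> \<gamma>) H).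
      weight n p g * sq_dist n (edge_image (\<pi> \<circ> \<gamma>) H) (A g)) \<ge>
      real (card \<Gamma>) * p ^ card H * (k - l - k * \<eta>)" if \<pi>: "\<pi> permutes {1..n}" for \<pi> A
    unfolding k_def
  proof (rule averaged_risk_lower[where S = "edge_image \<pi> S" and I = \<Gamma>
        and X = "\<lambda>\<gamma>. edge_image (\<pi> \<circ> \<gamma>) H"])
    have perm: "(\<pi> \<circ> \<gamma>) permutes {1..n}" if "\<gamma> \<in> \<Gamma>" for \<gamma>
      using \<Gamma>n[OF that] \<pi> by (rule permutes_compose)
    show "edge_image (\<pi> \<circ> \<gamma>) H \<subseteq> complete_graph n" if "\<gamma> \<in> \<Gamma>" for \<gamma>
      by (rule edge_image_subset_complete[OF H(1) perm[OF that]])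
    show "card (edge_image (\<pi> \<circ> \<gamma>) H) = card H" if "\<gamma> \<in> \<Gamma>" for \<gamma>
      using card_edge_image[OF permutes_inj[OF perm[OF that]]] .
    show "edge_image \<pi> S \<subseteq> edge_image (\<pi> \<circ> \<gamma>) H" if "\<gamma> \<in> \<Gamma>" for \<gamma>
    proof -
      have "edge_image \<gamma> S \<subseteq> edge_image \<gamma> H"
        unfolding edge_image_def by (rule image_mono[OF S(1)])
      hence "S \<subseteq> edge_image \<gamma> H" using fixS[OF that] by simp
      thus ?thesis unfolding edge_image_comp by (simp only: edge_image_def image_mono)
    qed
    have cS: "card (edge_image \<pi> S) = card S" using card_edge_image[OF permutes_inj[OF \<pi>]] .
    let ?X = "\<lambda>\<gamma>. edge_image (\<pi> \<circ> \<gamma>) H"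
    \<comment> \<open>Overlaps are invariant under a common left factor, so the sum over pairs is
      \<open>card \<Gamma>\<close> times the sum over single permutations bounded in
      \<open>sumF\<close>.\<close>
    have ov: "card (?X (\<sigma> \<circ> \<gamma>) \<inter> ?X \<sigma>) = card (edge_image \<gamma> H \<inter> H)" if "\<sigma> \<in> \<Gamma>" for \<sigma> \<gamma>
    proof -
      have i: "inj (\<pi> \<circ> \<sigma>)" using permutes_inj[OF perm[OF that]] .
      have "?X (\<sigma> \<circ> \<gamma>) \<inter> ?X \<sigma> = edge_image (\<pi> \<circ> \<sigma>) (edge_image \<gamma> H \<inter> H)"
        unfolding edge_image_Int[OF i] edge_image_comp[symmetric] comp_assoc ..
      thus ?thesis by (simp add: card_edge_image[OF i])
    qed
    have "(\<Sum>(i, j)\<in>{(i, j)\<in>\<Gamma> \<times> \<Gamma>. l \<le> real (card (?X i \<inter> ?X j))}. 1 / p ^ (card (?X i \<inter> ?X j) - card S))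
      = (\<Sum>(i, j)\<in>\<Gamma> \<times> \<Gamma>. ?F (card (?X i \<inter> ?X j)))"
      by (rule sum.mono_neutral_cong_left) (use f\<Gamma> in \<open>auto split: if_splits\<close>)
    also have "\<dots> = (\<Sum>j\<in>\<Gamma>. \<Sum>i\<in>\<Gamma>. ?F (card (?X i \<inter> ?X j)))"
      by (subst sum.cartesian_product[symmetric], rule sum.swap)
    also have "\<dots> = (\<Sum>j\<in>\<Gamma>. \<Sum>i\<in>\<Gamma>. ?F (card (edge_image i H \<inter> H)))"
    proof (rule sum.cong[OF refl])
      fix j assume j: "j \<in> \<Gamma>"
      hence "(\<Sum>i\<in>\<Gamma>. ?F (card (?X i \<inter> ?X j))) = (\<Sum>i\<in>\<Gamma>. ?F (card (?X (j \<circ> i) \<inter> ?X j)))"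
        unfolding \<Gamma>_def by (intro sum_permutations_compose_left) simp
      thus "(\<Sum>i\<in>\<Gamma>. ?F (card (?X i \<inter> ?X j))) = (\<Sum>i\<in>\<Gamma>. ?F (card (edge_image i H \<inter> H)))"
        by (simp only: ov[OF j])
    qed
    also have "\<dots> \<le> card \<Gamma> * (\<eta>\<^sup>2 * card \<Gamma>)"
      using sumF by (simp add: mult_left_mono)
    finally show "(\<Sum>(i, j)\<in>{(i, j)\<in>\<Gamma> \<times> \<Gamma>. l \<le> real (card (?X i \<inter> ?X j))}.
        1 / p ^ (card (?X i \<inter> ?X j) - card (edge_image \<pi> S))) \<le> \<eta>\<^sup>2 * (real (card \<Gamma>))\<^sup>2"
      by (simp add: cS power2_eq_square mult_ac)
    show "0 \<le> l" using q \<delta> k by (simp add: l_def)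
  qed (use f\<Gamma> p \<eta> in auto)
  have mse: "mse n H p A \<ge> k - l - k * \<eta>" for A
  proof -
    let ?f = "\<lambda>\<pi>. \<Sum>g\<in>supergraphs n (edge_image \<pi> H). weight n p g * sq_dist n (edge_image \<pi> H) (A g)"
    let ?P = "{\<pi>. \<pi> permutes {1..n}}"
    have cP: "real (card ?P) = fact n" using card_permutations[of "{1..n}" n] by simp
    have "card \<Gamma> * (\<Sum>\<pi>\<in>?P. ?f \<pi>) = (\<Sum>\<gamma>\<in>\<Gamma>. \<Sum>\<pi>\<in>?P. ?f \<pi>)" by simp
    also have "\<dots> = (\<Sum>\<gamma>\<in>\<Gamma>. \<Sum>\<pi>\<in>?P. ?f (\<pi> \<circ> \<gamma>))"
      by (intro sum.cong refl sum_permutations_compose_right \<Gamma>n)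
    also have "\<dots> = (\<Sum>\<pi>\<in>?P. \<Sum>\<gamma>\<in>\<Gamma>. ?f (\<pi> \<circ> \<gamma>))" by (rule sum.swap)
    also have "\<dots> \<ge> (\<Sum>\<pi>\<in>?P. real (card \<Gamma>) * p ^ card H * (k - l - k * \<eta>))"
      by (intro sum_mono cls) simp
    finally have "card \<Gamma> * (\<Sum>\<pi>\<in>?P. ?f \<pi>) \<ge> card \<Gamma> * (fact n * p ^ card H * (k - l - k * \<eta>))"
      by (simp only: sum_constant cP mult_ac)
    hence "(\<Sum>\<pi>\<in>?P. ?f \<pi>) \<ge> fact n * p ^ card H * (k - l - k * \<eta>)"
      by (simp only: c\<Gamma> mult_le_cancel_left_pos[OF fact_gt_zero])
    thus ?thesis unfolding mse_eq[OF H(1) p] using p by (simp add: pos_le_divide_eq mult.commute)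
  qed
  have "k - l - k * \<eta> \<le> (INF A. mse n H p A)" by (rule cINF_greatest) (auto simp: mse)
  hence "(k - l - k * \<eta>) / k \<le> mmse n H p"
    using k by (simp add: mmse_def k_def divide_right_mono)
  moreover have "(k - l - k * \<eta>) / k = 1 - q - \<delta> - \<eta>" using k by (simp add: l_def field_simps)
  ultimately show ?thesis by (simp add: \<eta>_def C_def)
qed

section \<open>Upper bound below the threshold\<close>

lemma vertices_edge_cover: "e \<in> A \<Longrightarrow> e \<subseteq> vertices A"
  by (auto simp: vertices_def)

lemma edge_image_cong:
  assumes "\<And>x. x \<in> vertices A \<Longrightarrow> f x = g x"
  shows "edge_image f A = edge_image g A"
  unfolding edge_image_def
  by (intro image_cong refl) (use assms vertices_edge_cover in blast)

text \<open>Each step supplied by the threshold satisfies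
  \<open>n ^ m * p ^ a \<le> (1 - \<epsilon>) ^ a\<close>, and these bounds multiply along a chain
  because new vertices and new edges add up. Instead of building the chain, take a maximal
  \<open>J\<close> with the accumulated bound: with at most \<open>q * card H\<close> edges it would
  admit one more step.\<close>

lemma threshold_chain:
  assumes H: "finite H" "H \<noteq> {}" "finite (vertices H)" and q: "q < 1" and n: "0 < n"
    and p: "0 < p" and \<epsilon>: "0 < \<epsilon>" "\<epsilon> < 1"
    and thr: "p \<le> (1 - \<epsilon>) * expectation_threshold q n H" and T: "T \<subseteq> H"
  obtains J where "T \<subseteq> J" "J \<subseteq> H" "q * real (card H) < real (card J)"
    "real n ^ card (vertices J - vertices T) * p ^ card (J - T) \<le> (1 - \<epsilon>) ^ card (J - T)"
proof -
  let ?good = "\<lambda>J. real n ^ card (vertices J - vertices T) * p ^ card (J - T) \<le> (1 - \<epsilon>) ^ card (J - T)"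
  let ?\<J> = "{J. T \<subseteq> J \<and> J \<subseteq> H \<and> ?good J}"
  have "finite ?\<J>" by (rule finite_subset[of _ "Pow H"]) (use H in auto)
  moreover have T0: "T \<in> ?\<J>" using T by simp
  ultimately obtain J where J0: "J \<in> ?\<J>" and max: "\<forall>J'\<in>?\<J>. J \<subseteq> J' \<longrightarrow> J = J'"
    using finite_has_maximal[of ?\<J>] by (metis (no_types, lifting) empty_iff)
  have J: "T \<subseteq> J" "J \<subseteq> H" "?good J" using J0 by auto
  have "q * real (card H) < real (card J)"
  proof (rule ccontr)
    assume "\<not> ?thesis"
    hence le: "real (card J) \<le> q * real (card H)" by simp
    obtain J' where J': "J' \<subseteq> H" "J \<subset> J'" "expectation_threshold q n H \<le>
      real n powr (- (real (card (vertices J' - vertices J)) / real (card (J' - J))))"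
      using expectation_threshold_le[OF H(1,2) q J(2) le, of n] by metis
    have fJ': "finite J'" using J'(1) H(1) by (rule finite_subset)
    define a where "a = card (J' - J)"
    define m where "m = card (vertices J' - vertices J)"
    have a: "a > 0" using J'(2) fJ' by (auto simp: a_def card_gt_0_iff)
    have "p \<le> (1 - \<epsilon>) * real n powr (- (real m / real a))"
      using thr J'(3) \<epsilon> unfolding m_def a_def
      by (meson diff_ge_0_iff_ge less_imp_le mult_left_mono order_trans)
    hence "p ^ a \<le> ((1 - \<epsilon>) * real n powr (- (real m / real a))) ^ a"
      using p by (intro power_mono) auto
    also have "\<dots> = (1 - \<epsilon>) ^ a / real n ^ m"
      using powr_minus_ratio_power[OF n a, of m] by (simp add: power_mult_distrib)
    finally have new: "real n ^ m * p ^ a \<le> (1 - \<epsilon>) ^ a"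
      using n by (simp add: pos_le_divide_eq mult.commute)
    have VJ': "vertices J \<subseteq> vertices J'" "vertices J' \<subseteq> vertices H" "vertices T \<subseteq> vertices J"
      using J' J(1) by (auto intro!: vertices_mono)
    hence fV: "finite (vertices J')" using H(3) finite_subset by blast
    have "vertices J' - vertices T = (vertices J' - vertices J) \<union> (vertices J - vertices T)"
      using VJ' by auto
    hence cV: "card (vertices J' - vertices T) = m + card (vertices J - vertices T)"
      unfolding m_def using fV VJ'
      by (simp only:) (rule card_Un_disjoint, auto intro: finite_subset)
    have "J' - T = (J' - J) \<union> (J - T)" using J'(2) J(1) by auto
    moreover have "card ((J' - J) \<union> (J - T)) = card (J' - J) + card (J - T)"
      using fJ' J'(2) by (intro card_Un_disjoint) (auto intro: finite_subset)
    ultimately have cE: "card (J' - T) = a + card (J - T)" by (simp add: a_def)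
    have "real n ^ (m + card (vertices J - vertices T)) * p ^ (a + card (J - T)) =
        (real n ^ m * p ^ a) * (real n ^ card (vertices J - vertices T) * p ^ card (J - T))"
      by (simp add: power_add)
    also have "\<dots> \<le> (1 - \<epsilon>) ^ a * (1 - \<epsilon>) ^ card (J - T)"
      using new J(3) p \<epsilon> by (intro mult_mono) auto
    finally have "?good J'" unfolding cV cE by (simp add: power_add)
    hence "J' \<in> ?\<J>" using J' J(1) by auto
    thus False using max J'(2) by blast
  qed
  thus ?thesis using J that by blast
qed

lemma sum_weight_union_bound:
  assumes Z: "finite Z" "\<And>z. z \<in> Z \<Longrightarrow> R z \<subseteq> complete_graph n" and p: "0 \<le> p" "p \<le> 1"
    and G: "G \<subseteq> Pow (complete_graph n)" "\<And>g. g \<in> G \<Longrightarrow> \<exists>z\<in>Z. R z \<subseteq> g"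
  shows "(\<Sum>g\<in>G. weight n p g) \<le> (\<Sum>z\<in>Z. p ^ card (R z))"
proof -
  have "(\<Sum>g\<in>G. weight n p g) \<le> (\<Sum>g\<in>G. \<Sum>z\<in>contained Z R g. weight n p g)"
  proof (rule sum_mono)
    fix g assume "g \<in> G"
    then obtain z where "z \<in> contained Z R g" using G(2) by (auto simp: contained_def)
    thus "weight n p g \<le> (\<Sum>z\<in>contained Z R g. weight n p g)"
      using Z(1) p by (intro member_le_sum[of z _ "\<lambda>_. weight n p g"]) (auto simp: weight_nonneg)
  qed
  also have "\<dots> \<le> (\<Sum>g\<in>Pow (complete_graph n). \<Sum>z\<in>contained Z R g. weight n p g)"
    using G(1) p by (intro sum_mono2) (auto intro!: sum_nonneg mult_nonneg_nonneg simp: weight_nonneg)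
  also have "\<dots> = (\<Sum>z\<in>Z. \<Sum>g\<in>supergraphs n (R z). weight n p g)"
    by (rule sum_supergraphs_swap[symmetric]) (use Z in auto)
  also have "\<dots> = (\<Sum>z\<in>Z. p ^ card (R z))"
    by (intro sum.cong refl sum_weight_supergraphs Z)
  finally show ?thesis .
qed

text \<open>The set of edges sent into \<open>Y\<close> depends only on a map from the vertices of \<open>H\<close> to those of \<open>Y\<close>
  and the dummy value 0, which is not a vertex.\<close>

lemma card_preimage_patterns:
  assumes V: "finite (vertices H)" "finite (vertices Y)" "0 \<notin> vertices Y"
  shows "finite ((\<lambda>\<rho>. {e \<in> H. \<rho> ` e \<in> Y}) ` R)"
    "card ((\<lambda>\<rho>. {e \<in> H. \<rho> ` e \<in> Y}) ` R) \<le> (card (vertices Y) + 1) ^ card (vertices H)"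
proof -
  let ?M = "PiE (vertices H) (\<lambda>_. insert (0::nat) (vertices Y))"
  let ?T = "\<lambda>\<rho>. {e \<in> H. \<rho> ` e \<in> Y}"
  have sub: "?T ` R \<subseteq> ?T ` ?M"
  proof
    fix T assume "T \<in> ?T ` R"
    then obtain \<rho> where \<rho>: "T = ?T \<rho>" by auto
    \<comment> \<open>All values outside \<open>vertices Y\<close> are collapsed to 0. An edge with
      such a value is sent into \<open>Y\<close> neither by \<open>\<rho>\<close> nor by
      \<open>f\<close>.\<close>
    define f where "f = restrict (\<lambda>x. if \<rho> x \<in> vertices Y then \<rho> x else 0) (vertices H)"
    have "\<rho> ` e \<in> Y \<longleftrightarrow> f ` e \<in> Y" if e: "e \<in> H" for e
    proof
      assume Y: "\<rho> ` e \<in> Y"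
      have "f x = \<rho> x" if "x \<in> e" for x
        using that Y vertices_edge_cover[OF e] vertices_edge_cover[OF Y] by (auto simp: f_def)
      hence "f ` e = \<rho> ` e" by (intro image_cong) auto
      thus "f ` e \<in> Y" using Y by simp
    next
      assume Y: "f ` e \<in> Y"
      have "f x = \<rho> x" if "x \<in> e" for x
      proof -
        have "f x \<noteq> 0" using that vertices_edge_cover[OF Y] V(3) by (metis image_eqI subsetD)
        thus ?thesis using that vertices_edge_cover[OF e] by (auto simp: f_def split: if_splits)
      qed
      hence "f ` e = \<rho> ` e" by (intro image_cong) auto
      thus "\<rho> ` e \<in> Y" using Y by simp
    qed
    hence "T = ?T f" unfolding \<rho> by auto
    moreover have "f \<in> ?M" by (auto simp: f_def)
    ultimately show "T \<in> ?T ` ?M" by blast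
  qed
  have fM: "finite ?M" using V by (intro finite_PiE) auto
  show "finite (?T ` R)" using sub fM by (meson finite_imageI finite_subset)
  have "card (?T ` R) \<le> card (?T ` ?M)" using sub fM by (intro card_mono) auto
  also have "\<dots> \<le> card ?M" by (rule card_image_le[OF fM])
  also have "\<dots> = (card (vertices Y) + 1) ^ card (vertices H)"
    using V by (simp add: card_PiE)
  finally show "card (?T ` R) \<le> (card (vertices Y) + 1) ^ card (vertices H)" .
qed

text \<open>Only new vertices may cost a factor \<open>n\<close>, since
  \<open>p ^ card (J - T)\<close> repays exactly those. The vertices of \<open>T\<close> have to
  land in \<open>V\<close>, which will be the vertex set of the hidden copy, and so cost only
  \<open>card V\<close> each.\<close>

lemma card_extension_images:
  assumes J: "finite (vertices J)" "vertices T \<subseteq> vertices J" and V: "finite V"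
    and R: "\<And>\<rho>. \<rho> \<in> R \<Longrightarrow> \<rho> ` vertices T \<subseteq> V" "\<And>\<rho>. \<rho> \<in> R \<Longrightarrow> \<rho> ` vertices J \<subseteq> {1..n}"
  shows "finite ((\<lambda>\<rho>. edge_image \<rho> (J - T)) ` R)"
    "card ((\<lambda>\<rho>. edge_image \<rho> (J - T)) ` R) \<le>
      card V ^ card (vertices T) * n ^ card (vertices J - vertices T)"
proof -
  let ?M = "PiE (vertices J) (\<lambda>x. if x \<in> vertices T then V else {1..n})"
  let ?D = "\<lambda>\<rho>. edge_image \<rho> (J - T)"
  have sub: "?D ` R \<subseteq> ?D ` ?M"
  proof
    fix D assume "D \<in> ?D ` R"
    then obtain \<rho> where \<rho>: "\<rho> \<in> R" "D = ?D \<rho>" by auto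
    have "D = ?D (restrict \<rho> (vertices J))"
      unfolding \<rho>(2) using vertices_mono[of "J - T" J] by (intro edge_image_cong) auto
    moreover have "restrict \<rho> (vertices J) \<in> ?M" using R[OF \<rho>(1)] by (auto simp: image_subset_iff)
    ultimately show "D \<in> ?D ` ?M" by blast
  qed
  have fM: "finite ?M" using J V by (intro finite_PiE) auto
  show "finite (?D ` R)" using sub fM by (meson finite_imageI finite_subset)
  have "card (?D ` R) \<le> card (?D ` ?M)" using sub fM by (intro card_mono) auto
  also have "\<dots> \<le> card ?M" by (rule card_image_le[OF fM])
  also have "\<dots> = (\<Prod>x\<in>vertices J. if x \<in> vertices T then card V else n)"
    using J by (simp add: card_PiE if_distrib cong: if_cong)
  also have "\<dots> = card V ^ card (vertices T) * n ^ card (vertices J - vertices T)"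
    using J by (simp add: prod.If_cases Int_absorb1 Diff_eq[symmetric])
  finally show "card (?D ` R) \<le> card V ^ card (vertices T) * n ^ card (vertices J - vertices T)" .
qed

text \<open>The exponent \<open>2 * v\<close> collects two counts: one factor
  \<open>(v + 1) ^ v\<close> for the pattern \<open>T\<close> of edges sent into the hidden copy,
  one for the placement of the vertices of \<open>T\<close> inside it.\<close>

lemma mmse_upper_bound:
  assumes H: "H \<subseteq> complete_graph n" "H \<noteq> {}" and q: "0 \<le> q" "q < 1"
    and p: "0 < p" "p \<le> 1" and \<epsilon>: "0 < \<epsilon>" "\<epsilon> < 1" and \<delta>: "0 < \<delta>"
    and thr: "p \<le> (1 - \<epsilon>) * expectation_threshold q n H"
  defines "k \<equiv> real (card H)" and "v \<equiv> card (vertices H)"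
  shows "mmse n H p \<le> 1 - q + \<delta> + (real v + 1) ^ (2 * v) * (1 - \<epsilon>) powr (\<delta> * k)"
proof -
  have fH: "finite H" using H(1) finite_complete_graph by (rule finite_subset)
  have k: "k > 0" using fH H(2) by (simp add: k_def card_gt_0_iff)
  have VH: "vertices H \<subseteq> {1..n}" by (rule vertices_subset[OF H(1)])
  have fV: "finite (vertices H)" using VH by (rule finite_subset) simp
  obtain e where e: "e \<in> H" using H(2) by auto
  have n: "n > 0"
  proof (rule ccontr)
    assume "\<not> n > 0"
    thus False using e H(1) by (auto simp: complete_graph_def nsets_def)
  qed
  \<comment> \<open>A bad pattern has fewer than \<open>(q - \<delta>) * k\<close> edges and its
    extension more than \<open>q * k\<close>, so at least \<open>\<delta> * k\<close> edges must
    come from the noise.\<close>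
  define l where "l = (q - \<delta>) * k"
  define C where "C = (1 - \<epsilon>) powr (\<delta> * k)"
  define \<beta> where "\<beta> = (real v + 1) ^ (2 * v) * C"
  define P where "P = {\<pi>. \<pi> permutes {1..n}}"
  have fP: "finite P" by (simp add: P_def finite_permutations)
  have cP: "real (card P) = fact n" using card_permutations[of "{1..n}" n] by (simp add: P_def)
  have C: "C > 0" using \<epsilon> by (simp add: C_def)
  have "\<forall>T\<in>Pow H. \<exists>J. T \<subseteq> J \<and> J \<subseteq> H \<and> q * k < real (card J) \<and>
      real n ^ card (vertices J - vertices T) * p ^ card (J - T) \<le> (1 - \<epsilon>) ^ card (J - T)"
  proof
    fix T assume "T \<in> Pow H"
    hence "T \<subseteq> H" by simp
    thus "\<exists>J. T \<subseteq> J \<and> J \<subseteq> H \<and> q * k < real (card J) \<and>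
      real n ^ card (vertices J - vertices T) * p ^ card (J - T) \<le> (1 - \<epsilon>) ^ card (J - T)"
      using threshold_chain[OF fH H(2) fV q(2) n p(1) \<epsilon> thr] unfolding k_def by metis
  qed
  \<comment> \<open>One extension is fixed per pattern before any copy is considered, so the choice
    of \<open>J\<close> adds nothing to the union bound.\<close>
  then obtain J where J: "\<And>T. T \<subseteq> H \<Longrightarrow> T \<subseteq> J T" "\<And>T. T \<subseteq> H \<Longrightarrow> J T \<subseteq> H"
      "\<And>T. T \<subseteq> H \<Longrightarrow> q * k < real (card (J T))"
      "\<And>T. T \<subseteq> H \<Longrightarrow> real n ^ card (vertices (J T) - vertices T) * p ^ card (J T - T)
        \<le> (1 - \<epsilon>) ^ card (J T - T)"
    unfolding Pow_iff[symmetric] by metis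
  let ?X = "\<lambda>\<pi>. edge_image \<pi> H"
  have X: "?X \<pi> \<subseteq> complete_graph n" "card (?X \<pi>) = card H" if "\<pi> \<in> P" for \<pi>
    using that edge_image_subset_complete[OF H(1)] by (auto simp: P_def card_edge_image permutes_inj)
  have bad: "(\<Sum>g | g \<in> supergraphs n (?X \<pi>) \<and>
        (\<exists>\<rho>\<in>P. ?X \<rho> \<subseteq> g \<and> real (card (?X \<pi> \<inter> ?X \<rho>)) < l). weight n p g) \<le> \<beta> * p ^ card H"
    if \<pi>: "\<pi> \<in> P" for \<pi>
  proof -
    define Y where "Y = ?X \<pi>"
    define T where "T \<rho> = {e \<in> H. \<rho> ` e \<in> Y}" for \<rho>
    define R where "R = {\<rho> \<in> P. real (card (Y \<inter> ?X \<rho>)) < l}"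
    define D where "D t = (\<lambda>\<rho>. edge_image \<rho> (J t - t)) ` {\<rho> \<in> R. T \<rho> = t}" for t
    define Z where "Z = Sigma (T ` R) D"
    have \<pi>': "\<pi> permutes {1..n}" using \<pi> by (simp add: P_def)
    have VY: "vertices Y = \<pi> ` vertices H" by (simp add: Y_def vertices_edge_image)
    have cVY: "card (vertices Y) = v"
      unfolding VY v_def by (rule card_image) (rule inj_on_subset[OF permutes_inj[OF \<pi>']], simp)
    have YK: "Y \<subseteq> complete_graph n" unfolding Y_def by (rule X(1)[OF \<pi>])
    have VYn: "vertices Y \<subseteq> {1..n}" by (rule vertices_subset[OF YK])
    have fVY: "finite (vertices Y)" using VYn by (rule finite_subset) simp
    have fY: "finite Y" using YK finite_complete_graph by (rule finite_subset)
    have cY: "card Y = card H" unfolding Y_def by (rule X(2)[OF \<pi>])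
    have TH: "T \<rho> \<subseteq> H" for \<rho> by (auto simp: T_def)
    have RP: "\<rho> permutes {1..n}" if "\<rho> \<in> R" for \<rho> using that by (simp add: R_def P_def)
    have Tim: "edge_image \<rho> (T \<rho>) = Y \<inter> ?X \<rho>" for \<rho> by (auto simp: T_def edge_image_def)
    have fT: "finite (T ` R)" and cT: "real (card (T ` R)) \<le> (real v + 1) ^ v"
    proof -
      have "0 \<notin> vertices Y" using VYn by auto
      note * = card_preimage_patterns[OF fV fVY this, of R, folded T_def]
      show "finite (T ` R)" by (rule *)
      have "card (T ` R) \<le> (v + 1) ^ v" using *(2) by (simp add: cVY v_def)
      hence "real (card (T ` R)) \<le> real ((v + 1) ^ v)" by (simp only: of_nat_le_iff)
      thus "real (card (T ` R)) \<le> (real v + 1) ^ v" by (simp add: add.commute)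
    qed
    have D: "finite (D t)" "card (D t) \<le> v ^ card (vertices t) * n ^ card (vertices (J t) - vertices t)"
      if t: "t \<in> T ` R" for t
    proof -
      have tH: "t \<subseteq> H" using t TH by auto
      have VJ: "vertices (J t) \<subseteq> vertices H" by (rule vertices_mono[OF J(2)[OF tH]])
      have fVJ: "finite (vertices (J t))" using VJ fV by (rule finite_subset)
      have a: "\<rho> ` vertices t \<subseteq> vertices Y" if "\<rho> \<in> {\<rho> \<in> R. T \<rho> = t}" for \<rho>
        using that vertices_edge_image[of \<rho> t] Tim[of \<rho>] vertices_mono[of "Y \<inter> ?X \<rho>" Y] by auto
      have b: "\<rho> ` vertices (J t) \<subseteq> {1..n}" if "\<rho> \<in> {\<rho> \<in> R. T \<rho> = t}" for \<rho>
      proof -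
        have "\<rho> permutes {1..n}" using that RP by blast
        thus ?thesis using VJ VH permutes_image[of \<rho> "{1..n}"] image_mono[of "vertices (J t)" "{1..n}" \<rho>] by auto
      qed
      note * = card_extension_images[OF fVJ vertices_mono[OF J(1)[OF tH]] fVY a b]
      show "finite (D t)" unfolding D_def by (rule *(1))
      show "card (D t) \<le> v ^ card (vertices t) * n ^ card (vertices (J t) - vertices t)"
        unfolding D_def using *(2) by (simp only: cVY)
    qed
    have fZ: "finite Z" unfolding Z_def using fT D(1) by (intro finite_SigmaI)
    have Zprop: "d \<inter> Y = {}" "card d = card (J t - t)" "d \<subseteq> complete_graph n"
      if z: "(t, d) \<in> Z" for t d
    proof -
      obtain \<rho> where \<rho>: "\<rho> \<in> R" "T \<rho> = t" "d = edge_image \<rho> (J t - t)"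
        using z by (auto simp: Z_def D_def)
      have tH: "t \<subseteq> H" using \<rho>(2) TH by auto
      show "card d = card (J t - t)" unfolding \<rho>(3) by (rule card_edge_image[OF permutes_inj[OF RP[OF \<rho>(1)]]])
      \<comment> \<open>Edges of \<open>H\<close> outside the pattern \<open>t\<close> are, by the
        definition of \<open>T\<close>, not sent into \<open>Y\<close>. Hence all of
        \<open>d\<close> has to be supplied by the noise.\<close>
      show "d \<inter> Y = {}" using J(2)[OF tH] \<rho>(2,3) by (auto simp: T_def edge_image_def)
      show "d \<subseteq> complete_graph n"
        unfolding \<rho>(3) using J(2)[OF tH] H(1) by (intro edge_image_subset_complete RP[OF \<rho>(1)]) auto
    qed
    have "(\<Sum>g | g \<in> supergraphs n Y \<and> (\<exists>\<rho>\<in>P. ?X \<rho> \<subseteq> g \<and> real (card (Y \<inter> ?X \<rho>)) < l). weight n p g)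
        \<le> (\<Sum>z\<in>Z. p ^ card (Y \<union> snd z))"
    proof (rule sum_weight_union_bound)
      show "Y \<union> snd z \<subseteq> complete_graph n" if "z \<in> Z" for z
        using that YK Zprop(3)[of "fst z" "snd z"] by auto
      fix g assume "g \<in> {g \<in> supergraphs n Y. \<exists>\<rho>\<in>P. ?X \<rho> \<subseteq> g \<and> real (card (Y \<inter> ?X \<rho>)) < l}"
      then obtain \<rho> where g: "Y \<subseteq> g" and \<rho>: "\<rho> \<in> R" "?X \<rho> \<subseteq> g"
        by (auto simp: supergraphs_def R_def)
      have "(T \<rho>, edge_image \<rho> (J (T \<rho>) - T \<rho>)) \<in> Z" using \<rho>(1) by (auto simp: Z_def D_def)
      moreover have "edge_image \<rho> (J (T \<rho>) - T \<rho>) \<subseteq> ?X \<rho>"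
        using J(2)[OF TH[of \<rho>]] by (auto simp: edge_image_def)
      ultimately show "\<exists>z\<in>Z. Y \<union> snd z \<subseteq> g" using g \<rho>(2)
        by (intro bexI[of _ "(T \<rho>, edge_image \<rho> (J (T \<rho>) - T \<rho>))"]) auto
    qed (use fZ p in \<open>auto simp: supergraphs_def\<close>)
    \<comment> \<open>Disjointness separates the factor \<open>p ^ card H\<close> of the hidden
      copy, which the normalisation in \<open>mse_eq\<close> cancels.\<close>
    also have "\<dots> = (\<Sum>(t, d)\<in>Z. p ^ card H * p ^ card (J t - t))"
    proof (rule sum.cong[OF refl], clarify)
      fix t d assume z: "(t, d) \<in> Z"
      have "finite d" using Zprop(3)[OF z] finite_complete_graph by (rule finite_subset)
      hence "card (Y \<union> d) = card H + card (J t - t)"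
        using Zprop[OF z] fY cY by (subst card_Un_disjoint) auto
      thus "p ^ card (Y \<union> snd (t, d)) = p ^ card H * p ^ card (J t - t)" by (simp add: power_add)
    qed
    also have "\<dots> = (\<Sum>t\<in>T ` R. \<Sum>d\<in>D t. p ^ card H * p ^ card (J t - t))"
      unfolding Z_def by (rule sum.Sigma[symmetric]) (use fT D(1) in auto)
    also have "\<dots> \<le> (\<Sum>t\<in>T ` R. p ^ card H * ((real v + 1) ^ v * C))"
    proof (rule sum_mono)
      fix t assume t: "t \<in> T ` R"
      hence tH: "t \<subseteq> H" using TH by auto
      have ft: "finite t" using tH fH by (rule finite_subset)
      obtain \<rho> where \<rho>: "\<rho> \<in> R" "t = T \<rho>" using t by auto
      have "card t = card (Y \<inter> ?X \<rho>)"
        unfolding \<rho>(2) Tim[symmetric] by (rule card_edge_image[symmetric, OF permutes_inj[OF RP[OF \<rho>(1)]]])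
      hence tl: "real (card t) < l" using \<rho>(1) by (simp add: R_def)
      define j where "j = card (J t - t)"
      have fJ: "finite (J t)" using J(2)[OF tH] fH by (rule finite_subset)
      have "card (J t) = card t + j"
        using J(1)[OF tH] ft fJ by (simp add: j_def card_Diff_subset card_mono)
      hence jk: "\<delta> * k \<le> real j" using J(3)[OF tH] tl by (simp add: l_def algebra_simps)
      have "real (card (D t)) \<le> real (v ^ card (vertices t) * n ^ card (vertices (J t) - vertices t))"
        using D(2)[OF t] by (simp only: of_nat_le_iff)
      hence "real (card (D t)) * p ^ j \<le>
          real v ^ card (vertices t) * (real n ^ card (vertices (J t) - vertices t) * p ^ j)"
        using p mult_right_mono[of "real (card (D t))" _ "p ^ j"] by (simp add: mult.assoc)
      also have "\<dots> \<le> (real v + 1) ^ v * C"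
      proof (rule mult_mono)
        have "card (vertices t) \<le> v"
          unfolding v_def using fV by (intro card_mono vertices_mono tH)
        hence "(real v + 1) ^ card (vertices t) \<le> (real v + 1) ^ v" by (intro power_increasing) auto
        moreover have "real v ^ card (vertices t) \<le> (real v + 1) ^ card (vertices t)"
          by (intro power_mono) auto
        ultimately show "real v ^ card (vertices t) \<le> (real v + 1) ^ v" by linarith
        have "real n ^ card (vertices (J t) - vertices t) * p ^ j \<le> (1 - \<epsilon>) ^ j"
          unfolding j_def by (rule J(4)[OF tH])
        also have "\<dots> = (1 - \<epsilon>) powr real j" using \<epsilon> by (simp add: powr_realpow)
        also have "\<dots> \<le> C" unfolding C_def using \<epsilon> jk by (intro powr_mono') auto
        finally show "real n ^ card (vertices (J t) - vertices t) * p ^ j \<le> C" .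
      qed (use p in auto)
      finally have "p ^ card H * (real (card (D t)) * p ^ j) \<le> p ^ card H * ((real v + 1) ^ v * C)"
        using p by (intro mult_left_mono) auto
      thus "(\<Sum>d\<in>D t. p ^ card H * p ^ card (J t - t)) \<le> p ^ card H * ((real v + 1) ^ v * C)"
        by (simp add: j_def mult_ac)
    qed
    also have "\<dots> \<le> (real v + 1) ^ v * (p ^ card H * ((real v + 1) ^ v * C))"
      using cT p C by (simp add: mult_right_mono)
    also have "\<dots> = \<beta> * p ^ card H"
      unfolding \<beta>_def mult_2 power_add by (simp only: mult_ac)
    finally show ?thesis by (simp only: Y_def)
  qed
  let ?A = "\<lambda>g. mean_indicator (contained P ?X g) ?X"
  have "(\<Sum>\<pi>\<in>P. \<Sum>g\<in>supergraphs n (?X \<pi>). weight n p g * sq_dist n (?X \<pi>) (?A g))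
      \<le> real (card P) * p ^ card H * (k - l + k * \<beta>)"
    unfolding k_def
  proof (rule averaged_risk_upper)
    show "l \<le> real (card H)" using q \<delta> k mult_right_mono[of "q - \<delta>" 1 k]
      by (simp add: l_def k_def)
  qed (use fP X p bad in auto)
  hence "mse n H p ?A \<le> k - l + k * \<beta>"
    unfolding mse_eq[OF H(1) p] cP P_def[symmetric] using p
    by (simp add: pos_divide_le_eq mult_ac)
  hence "mse n H p ?A / k \<le> (k - l + k * \<beta>) / k" using k by (simp add: divide_right_mono)
  moreover have "(k - l + k * \<beta>) / k = 1 - q + \<delta> + \<beta>" using k by (simp add: l_def field_simps)
  ultimately show ?thesis
    using mmse_le_mse[of n H p ?A] by (simp add: \<beta>_def C_def k_def)
qed

section \<open>Asymptotics\<close>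

lemma expectation_threshold_bounds:
  assumes H: "finite H" "H \<noteq> {}" and q: "0 \<le> q" "q < 1" and n: "0 < n"
  shows "0 < expectation_threshold q n H" "expectation_threshold q n H \<le> 1"
proof -
  obtain S where S: "S \<subseteq> H" "real (card S) \<le> q * real (card H)"
    and SJ: "\<And>J. J \<subseteq> H \<Longrightarrow> S \<subset> J \<Longrightarrow>
      real n powr (- (real (card (vertices J - vertices S)) / real (card (J - S))))
        \<le> expectation_threshold q n H"
    using expectation_threshold_attained[OF H q, of n] by metis
  have "0 < real n powr (- (real (card (vertices H - vertices S)) / real (card (H - S))))"
    using n by simp
  also have "\<dots> \<le> expectation_threshold q n H"
    using threshold_sets_nonempty[OF H q(2) S] by (intro SJ) auto
  finally show "0 < expectation_threshold q n H" .
  obtain J where "expectation_threshold q n H \<le>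
      real n powr (- (real (card (vertices J - vertices {})) / real (card (J - {}))))"
    by (rule expectation_threshold_le[OF H q(2), of "{}" n]) (use q in auto)
  also have "\<dots> \<le> real n powr 0" using n by (intro powr_mono) auto
  finally show "expectation_threshold q n H \<le> 1" using n by simp
qed

text \<open>An infimum of continuous functions need not be continuous, hence the passage through the
  explicit overlap formula, whose only pole is at 0. The endpoint 1 is included for the intermediate
  value argument.\<close>

lemma continuous_on_mmse:
  assumes H: "H \<subseteq> complete_graph n"
  shows "continuous_on {0<..1} (mmse n H)"
proof -
  let ?J = "contained {\<pi>. \<pi> permutes {1..n}} (\<lambda>\<pi>. edge_image \<pi> H)"
  let ?R = "\<lambda>g. real (card (?J g)) * real (card H)
       - overlap_sum (?J g) (\<lambda>\<pi>. edge_image \<pi> H) / real (card (?J g))"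
  have "continuous_on {0<..1} (\<lambda>p. (\<Sum>g\<in>Pow (complete_graph n). weight n p g * ?R g)
     / (fact n * p ^ card H) / real (card H))"
    unfolding weight_def divide_inverse[of _ "real (card H)"]
    by (intro continuous_intros) auto
  thus ?thesis
    by (subst continuous_on_cong[OF refl mmse_eq_overlap[OF H]]) auto
qed

text \<open>Transitivity on subsets of equal size; for pairs it makes all edges of the complete
  graph equivalent.\<close>

lemma exists_permutes_image:
  assumes "finite B" "e \<subseteq> B" "f \<subseteq> B" "card e = card f"
  shows "\<exists>\<tau>. \<tau> permutes B \<and> \<tau> ` e = f"
proof -
  have fin: "finite e" "finite f" using assms finite_subset by auto
  obtain g where g: "bij_betw g e f"
    using finite_same_card_bij[OF fin assms(4)] by auto
  have "card (B - e) = card (B - f)" using assms fin by (simp add: card_Diff_subset)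
  then obtain h where h: "bij_betw h (B - e) (B - f)"
    using finite_same_card_bij[of "B - e" "B - f"] assms(1) by auto
  define \<tau> where "\<tau> = (\<lambda>x. if x \<in> B then if x \<in> e then g x else h x else x)"
  have "bij_betw (\<lambda>x. if x \<in> e then g x else h x) (e \<union> (B - e)) (f \<union> (B - f))"
    by (rule bij_betw_disjoint_Un[OF g h]) auto
  hence "bij_betw (\<lambda>x. if x \<in> e then g x else h x) B B" using assms by (simp add: Un_absorb1)
  hence "bij_betw \<tau> B B" by (rule bij_betw_cong[THEN iffD1, rotated]) (simp add: \<tau>_def)
  hence "\<tau> permutes B" by (rule bij_imp_permutes) (simp add: \<tau>_def)
  moreover have "\<tau> ` e = g ` e" using assms(2) by (intro image_cong) (auto simp: \<tau>_def)
  ultimately show ?thesis using g by (auto simp: bij_betw_def)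
qed

text \<open>At \<open>p = 1\<close> the observed graph is always complete. By symmetry every edge
  lies in equally many permuted copies, namely \<open>d e\<close>, so the posterior mean is constant
  and the bound of \<open>mmse_le_one_minus_density\<close> is attained.\<close>

lemma mmse_at_one:
  assumes H: "H \<subseteq> complete_graph n" "H \<noteq> {}"
  shows "mmse n H 1 = 1 - real (card H) / real (card (complete_graph n))"
proof -
  let ?K = "complete_graph n"
  let ?X = "\<lambda>\<pi>. edge_image \<pi> H"
  define P where "P = {\<pi>. \<pi> permutes {1..n}}"
  define d where "d e = card {\<pi> \<in> P. e \<in> ?X \<pi>}" for e
  define k where "k = card H"
  have fH: "finite H" using H(1) finite_complete_graph by (rule finite_subset)
  have k0: "k > 0" using H fH by (auto simp: k_def card_gt_0_iff)
  have K0: "card ?K > 0" using H by (auto simp: card_gt_0_iff)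
  have fP: "finite P" by (simp add: P_def finite_permutations)
  have cP: "real (card P) = fact n" using card_permutations[of "{1..n}" n] by (simp add: P_def)
  have X: "?X \<pi> \<subseteq> ?K" "card (?X \<pi>) = k" if "\<pi> \<in> P" for \<pi>
    using that edge_image_subset_complete[OF H(1)] by (auto simp: P_def k_def card_edge_image permutes_inj)
  have fX: "finite (?X \<pi>)" for \<pi> using fH by (simp add: edge_image_def)
  have mono: "d e \<le> d f" if e: "e \<in> ?K" and f: "f \<in> ?K" for e f
  proof -
    obtain \<tau> where \<tau>: "\<tau> permutes {1..n}" "\<tau> ` e = f"
      using exists_permutes_image[of "{1..n}" e f] e f by (auto simp: complete_graph_def nsets_def)
    have "\<tau> \<circ> \<pi> \<in> {\<pi> \<in> P. f \<in> ?X \<pi>}" if "\<pi> \<in> {\<pi> \<in> P. e \<in> ?X \<pi>}" for \<pi>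
      using that \<tau> by (auto simp: P_def edge_image_comp permutes_compose) (auto simp: edge_image_def)
    moreover have "inj_on (\<lambda>\<pi>. \<tau> \<circ> \<pi>) {\<pi> \<in> P. e \<in> ?X \<pi>}"
      using permutes_inj[OF \<tau>(1)] by (auto simp: inj_on_def fun_eq_iff dest: injD)
    ultimately show ?thesis unfolding d_def using fP by (intro card_inj_on_le) auto
  qed
  have dsum: "(\<Sum>e\<in>?K. d e) = card P * k"
  proof -
    have "(\<Sum>e\<in>?K. d e) = (\<Sum>e\<in>?K. \<Sum>\<pi> | \<pi> \<in> P \<and> e \<in> ?X \<pi>. 1)" by (simp add: d_def)
    also have "\<dots> = (\<Sum>\<pi>\<in>P. \<Sum>e | e \<in> ?K \<and> e \<in> ?X \<pi>. 1)"
      by (rule sum.swap_restrict) (use fP in auto)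
    also have "\<dots> = (\<Sum>\<pi>\<in>P. k)"
    proof (rule sum.cong[OF refl])
      fix \<pi> assume \<pi>: "\<pi> \<in> P"
      have "{e. e \<in> ?K \<and> e \<in> ?X \<pi>} = ?X \<pi>" using X(1)[OF \<pi>] by auto
      thus "(\<Sum>e | e \<in> ?K \<and> e \<in> ?X \<pi>. 1) = k" using X(2)[OF \<pi>] by simp
    qed
    finally show ?thesis by simp
  qed
  have d: "real (d e) = fact n * real k / real (card ?K)" if e: "e \<in> ?K" for e
  proof -
    have "(\<Sum>f\<in>?K. d f) = (\<Sum>f\<in>?K. d e)"
      by (intro sum.cong refl) (use mono e le_antisym in blast)
    hence "card ?K * d e = card P * k" using dsum by simp
    hence "real (card ?K) * real (d e) = fact n * real k" by (metis cP of_nat_mult)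
    thus ?thesis using K0 by (subst nonzero_eq_divide_eq) (auto simp: mult.commute)
  qed
  have "overlap_sum P ?X = (\<Sum>\<pi>\<in>P. real k * (fact n * real k / real (card ?K)))"
    unfolding overlap_sum_def
  proof (rule sum.cong[OF refl])
    fix \<pi> assume \<pi>: "\<pi> \<in> P"
    have "(\<Sum>\<rho>\<in>P. real (card (?X \<pi> \<inter> ?X \<rho>))) = (\<Sum>\<rho>\<in>P. \<Sum>e | e \<in> ?X \<pi> \<and> e \<in> ?X \<rho>. 1)"
      by (simp add: Int_def)
    also have "\<dots> = (\<Sum>e\<in>?X \<pi>. \<Sum>\<rho> | \<rho> \<in> P \<and> e \<in> ?X \<rho>. 1)"
      by (rule sum.swap_restrict) (use fP fX in auto)
    also have "\<dots> = (\<Sum>e\<in>?X \<pi>. real (d e))" by (simp add: d_def)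
    also have "\<dots> = (\<Sum>e\<in>?X \<pi>. fact n * real k / real (card ?K))"
      using X(1)[OF \<pi>] by (intro sum.cong refl d) auto
    finally show "(\<Sum>\<rho>\<in>P. real (card (?X \<pi> \<inter> ?X \<rho>))) = real k * (fact n * real k / real (card ?K))"
      by (simp add: X(2)[OF \<pi>])
  qed
  hence ov: "overlap_sum P ?X = fact n * (real k * (fact n * real k / real (card ?K)))"
    by (simp add: cP)
  have w: "weight n 1 g = (if g = ?K then 1 else 0)" if "g \<in> Pow ?K" for g
  proof (cases "g = ?K")
    case False
    hence "card g < card ?K" using that by (intro psubset_card_mono) auto
    thus ?thesis using False by (simp add: weight_def)
  qed (simp add: weight_def)
  have cK: "contained P ?X ?K = P" using X(1) by (auto simp: contained_def)
  let ?R = "\<lambda>g. real (card (contained P ?X g)) * real k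
       - overlap_sum (contained P ?X g) ?X / real (card (contained P ?X g))"
  have "mmse n H 1 = (\<Sum>g\<in>Pow ?K. weight n 1 g * ?R g) / (fact n * 1 ^ k) / real k"
    unfolding P_def k_def by (rule mmse_eq_overlap[OF H(1)]) simp_all
  also have "(\<Sum>g\<in>Pow ?K. weight n 1 g * ?R g) = (\<Sum>g\<in>Pow ?K. if g = ?K then ?R g else 0)"
    by (rule sum.cong[OF refl]) (simp add: w)
  also have "\<dots> = fact n * real k - overlap_sum P ?X / fact n"
    by (subst sum.delta) (auto simp: cK cP)
  finally have "mmse n H 1 = (fact n * real k - overlap_sum P ?X / fact n) / fact n / real k"
    by simp
  also have "\<dots> = 1 - real k / real (card ?K)"
    using k0 by (simp add: ov diff_divide_distrib)
  finally show ?thesis by (simp add: k_def)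
qed

section \<open>Consequences of weak density\<close>

lemma weakly_dense_eventually:
  assumes "weakly_dense H" and M: "0 < M"
  shows "\<forall>\<^sub>F n in sequentially. card (vertices (H n)) \<ge> 2 \<and>
    real (card (H n)) > M * (real (card (vertices (H n))) * ln (real (card (vertices (H n)))))"
proof -
  have "\<forall>\<^sub>F n in sequentially. ereal M < ereal (real (card (H n)) /
      (real (card (vertices (H n))) * ln (real (card (vertices (H n))))))"
    by (rule less_LiminfD) (use assms in \<open>simp add: weakly_dense_def\<close>)
  thus ?thesis
  proof eventually_elim
    case (elim n)
    define v where "v = card (vertices (H n))"
    have *: "M < real (card (H n)) / (real v * ln (real v))" using elim by (simp add: v_def)
    \<comment> \<open>In both cases the denominator \<open>v * ln v\<close> is 0, so the quotient is
      0 by convention and cannot exceed \<open>M\<close>.\<close>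
    have "v \<noteq> 0" "v \<noteq> 1" by (rule notI, use * M in simp)+
    hence v: "v \<ge> 2" by linarith
    hence "real v * ln (real v) > 0" by simp
    thus ?case using * v by (simp add: pos_less_divide_eq v_def)
  qed
qed

lemma weakly_dense_decay:
  assumes H: "weakly_dense H" and c: "1 < c"
  shows "(\<lambda>n. (real (card (vertices (H n))) + 1) ^ (2 * card (vertices (H n))) *
    c powr (- real (card (H n)))) \<longlonglongrightarrow> 0"
proof (rule tendstoI)
  fix \<eta> :: real assume \<eta>: "\<eta> > 0"
  define t where "t = max 1 (1 - ln \<eta>)"
  have t: "t > 0" "exp (- t) < \<eta>"
  proof -
    have "- t < ln \<eta>" by (simp add: t_def)
    thus "exp (- t) < \<eta>" using \<eta> by (metis exp_less_mono exp_ln)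
  qed (simp add: t_def)
  have lc: "ln c > 0" using c by simp
  \<comment> \<open>Of the \<open>4 + t\<close> multiples of \<open>v * ln v\<close>, four pay for
    \<open>2 * v * ln (v + 1)\<close>, because \<open>v + 1 \<le> v * v\<close>. The other
    \<open>t\<close> leave at most \<open>exp (- t) < \<eta>\<close>, because
    \<open>v * ln v \<ge> 1\<close>.\<close>
  hence "0 < (4 + t) / ln c" using t by simp
  from weakly_dense_eventually[OF H this]
  show "\<forall>\<^sub>F n in sequentially. dist ((real (card (vertices (H n))) + 1) ^ (2 * card (vertices (H n))) *
    c powr (- real (card (H n)))) 0 < \<eta>"
  proof eventually_elim
    case (elim n)
    define v where "v = real (card (vertices (H n)))"
    define k where "k = real (card (H n))"
    have v: "v \<ge> 2" and k: "k > (4 + t) / ln c * (v * ln v)" using elim by (simp_all add: v_def k_def)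
    have "ln 2 \<ge> (1 / 2 :: real)" using ln2_ge_two_thirds by linarith
    hence "ln v \<ge> 1 / 2" using v by (smt (verit) ln_mono)
    hence vl: "v * ln v \<ge> 1" using v mult_mono[of 2 v "1 / 2" "ln v"] by simp
    have "v + 1 \<le> v * v" using v mult_right_mono[of 2 v v] by linarith
    hence "ln (v + 1) \<le> ln (v * v)" using v by (intro ln_mono) auto
    hence l1: "ln (v + 1) \<le> 2 * ln v" using v by (simp add: ln_mult)
    have kc: "k * ln c \<ge> (4 + t) * (v * ln v)" using k lc by (simp add: field_simps)
    have "(v + 1) ^ (2 * card (vertices (H n))) = exp (2 * v * ln (v + 1))"
      using v by (simp add: v_def powr_realpow[symmetric] powr_def)
    moreover have "c powr (- k) = exp (- (k * ln c))" using c by (simp add: powr_def)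
    ultimately have "(v + 1) ^ (2 * card (vertices (H n))) * c powr (- k) =
        exp (2 * v * ln (v + 1) - k * ln c)" by (simp add: exp_add[symmetric])
    also have "\<dots> \<le> exp (- t)"
    proof -
      have "2 * v * ln (v + 1) \<le> 2 * v * (2 * ln v)" using l1 v by (intro mult_left_mono) auto
      moreover have "t * 1 \<le> t * (v * ln v)" using vl t by (intro mult_left_mono) auto
      ultimately show ?thesis using kc by (simp add: algebra_simps)
    qed
    also have "\<dots> < \<eta>" by (rule t)
    finally show ?case using v c by (simp add: v_def k_def abs_mult)
  qed
qed

lemma eventually_nonempty:
  assumes "\<And>n. H n \<subseteq> complete_graph n" "weakly_dense H"
  shows "\<forall>\<^sub>F n in sequentially. H n \<noteq> {} \<and> finite (H n) \<and> 0 < n"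
  using weakly_dense_eventually[OF assms(2) zero_less_one]
proof eventually_elim
  case (elim n)
  have fH: "finite (H n)" using assms(1) finite_complete_graph by (rule finite_subset)
  have ne: "H n \<noteq> {}" using elim by (auto simp: vertices_def)
  have "n \<noteq> 0"
  proof
    assume "n = 0"
    thus False using assms(1)[of n] ne by (auto simp: complete_graph_def nsets_def)
  qed
  thus ?case using fH ne by simp
qed

text \<open>The noise level is quantified inside \<open>eventually\<close>: one bound on
  \<open>n\<close> serves all \<open>p\<close>, including those chosen after \<open>n\<close> in
  \<open>eventually_near_critical\<close>.\<close>

lemma eventually_mmse_lower:
  assumes H: "\<And>n. H n \<subseteq> complete_graph n" "weakly_dense H" and q: "0 \<le> q" "q < 1"
    and \<epsilon>: "0 < \<epsilon>" and \<eta>: "0 < \<eta>"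
  shows "\<forall>\<^sub>F n in sequentially. \<forall>p. 0 < p \<and> p \<le> 1 \<and> (1 + \<epsilon>) * expectation_threshold q n (H n) \<le> p \<longrightarrow>
    1 - q - \<eta> \<le> mmse n (H n) p"
proof -
  \<comment> \<open>One half of \<open>\<eta>\<close> is spent on the excess overlap, the other on
    the square root; this is why the decaying term is asked to fall below
    \<open>\<delta>\<^sup>2\<close>.\<close>
  define \<delta> where "\<delta> = \<eta> / 2"
  have \<delta>: "\<delta> > 0" using \<eta> by (simp add: \<delta>_def)
  have c: "1 < (1 + \<epsilon>) powr \<delta>" using \<epsilon> \<delta> by (simp add: gr_one_powr)
  have "\<delta>\<^sup>2 > 0" using \<delta> by simp
  from order_tendstoD(2)[OF weakly_dense_decay[OF H(2) c] this] eventually_nonempty[OF H]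
  show ?thesis
  proof eventually_elim
    case (elim n)
    show ?case
    proof (intro allI impI, elim conjE)
      fix p assume p: "0 < p" "p \<le> 1" "(1 + \<epsilon>) * expectation_threshold q n (H n) \<le> p"
      let ?v = "card (vertices (H n))" and ?k = "real (card (H n))"
      have "(real ?v + 1) ^ ?v * (1 + \<epsilon>) powr (- \<delta> * ?k) \<le>
          (real ?v + 1) ^ (2 * ?v) * (1 + \<epsilon>) powr (- \<delta> * ?k)"
        by (intro mult_right_mono power_increasing) auto
      also have "\<dots> = (real ?v + 1) ^ (2 * ?v) * ((1 + \<epsilon>) powr \<delta>) powr (- ?k)"
        by (simp add: powr_powr)
      also have "\<dots> < \<delta>\<^sup>2" using elim by simp
      finally have "sqrt ((real ?v + 1) ^ ?v * (1 + \<epsilon>) powr (- \<delta> * ?k)) < \<delta>"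
        using \<delta> by (metis abs_of_pos real_sqrt_abs real_sqrt_less_iff)
      moreover have "1 - q - \<delta> - sqrt ((real ?v + 1) ^ ?v * (1 + \<epsilon>) powr (- \<delta> * ?k)) \<le> mmse n (H n) p"
        using elim by (intro mmse_lower_bound H(1) q p \<epsilon> \<delta>) auto
      ultimately show "1 - q - \<eta> \<le> mmse n (H n) p" by (simp add: \<delta>_def)
    qed
  qed
qed

lemma eventually_mmse_upper:
  assumes H: "\<And>n. H n \<subseteq> complete_graph n" "weakly_dense H" and q: "0 \<le> q" "q < 1"
    and \<epsilon>: "0 < \<epsilon>" "\<epsilon> < 1" and \<eta>: "0 < \<eta>"
  shows "\<forall>\<^sub>F n in sequentially. \<forall>p. 0 < p \<and> p \<le> 1 \<and> p \<le> (1 - \<epsilon>) * expectation_threshold q n (H n) \<longrightarrow>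
    mmse n (H n) p \<le> 1 - q + \<eta>"
proof -
  define \<delta> where "\<delta> = \<eta> / 2"
  have \<delta>: "\<delta> > 0" using \<eta> by (simp add: \<delta>_def)
  have c: "1 < (1 - \<epsilon>) powr (- \<delta>)"
    using \<epsilon> \<delta> powr_less_mono2_neg[of "- \<delta>" "1 - \<epsilon>" 1] by simp
  from order_tendstoD(2)[OF weakly_dense_decay[OF H(2) c] \<delta>] eventually_nonempty[OF H]
  show ?thesis
  proof eventually_elim
    case (elim n)
    show ?case
    proof (intro allI impI, elim conjE)
      fix p assume p: "0 < p" "p \<le> 1" "p \<le> (1 - \<epsilon>) * expectation_threshold q n (H n)"
      let ?v = "card (vertices (H n))" and ?k = "real (card (H n))"
      have "(real ?v + 1) ^ (2 * ?v) * (1 - \<epsilon>) powr (\<delta> * ?k) < \<delta>"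
        using elim by (simp add: powr_powr)
      moreover have "mmse n (H n) p \<le> 1 - q + \<delta> + (real ?v + 1) ^ (2 * ?v) * (1 - \<epsilon>) powr (\<delta> * ?k)"
        using elim by (intro mmse_upper_bound H(1) q p \<epsilon> \<delta>) auto
      ultimately show "mmse n (H n) p \<le> 1 - q + \<eta>" by (simp add: \<delta>_def)
    qed
  qed
qed

section \<open>Noise levels at criticality\<close>

lemma eventually_near_critical:
  assumes H: "\<And>n. H n \<subseteq> complete_graph n" "weakly_dense H" and q: "0 \<le> q" "q < 1"
    and dens: "limsup (\<lambda>n. ereal (real (card (H n)) / real (card (complete_graph n)))) \<le> ereal q"
    and \<epsilon>: "0 < \<epsilon>" "\<epsilon> < 1"
  shows "\<forall>\<^sub>F n in sequentially. \<exists>p\<in>{0<..<1}.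
    \<bar>p / expectation_threshold q n (H n) - 1\<bar> \<le> \<epsilon> \<and> \<bar>mmse n (H n) p - (1 - q)\<bar> \<le> \<epsilon>"
proof -
  have \<epsilon>2: "0 < \<epsilon> / 2" using \<epsilon> by simp
  have "\<forall>\<^sub>F n in sequentially. ereal (real (card (H n)) / real (card (complete_graph n))) < ereal (q + \<epsilon> / 2)"
    by (rule Limsup_lessD) (rule le_less_trans[OF dens], use \<epsilon> in simp)
  with eventually_nonempty[OF H] eventually_mmse_lower[OF H q \<epsilon>(1) \<epsilon>2] eventually_mmse_upper[OF H q \<epsilon> \<epsilon>2]
  show ?thesis
  proof eventually_elim
    case (elim n)
    define \<phi> where "\<phi> = expectation_threshold q n (H n)"
    have \<phi>: "0 < \<phi>" "\<phi> \<le> 1" unfolding \<phi>_def using elim q by (auto intro: expectation_threshold_bounds)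
    define lo where "lo = (1 - \<epsilon>) * \<phi>"
    define hi where "hi = min 1 ((1 + \<epsilon>) * \<phi>)"
    have lo: "0 < lo" using \<phi> \<epsilon> by (simp add: lo_def)
    have "lo < \<phi>" using \<phi> \<epsilon> by (simp add: lo_def)
    moreover have "\<phi> \<le> hi" using \<phi> \<epsilon> by (simp add: hi_def)
    ultimately have lohi: "lo < hi" by simp
    have hi: "hi \<le> 1" by (simp add: hi_def)
    let ?m = "mmse n (H n)"
    have mlo: "?m lo \<le> 1 - q + \<epsilon> / 2"
      using elim lo lohi hi by (auto simp: lo_def \<phi>_def)
    have mhi: "1 - q - \<epsilon> / 2 \<le> ?m hi"
    proof (cases "(1 + \<epsilon>) * \<phi> \<le> 1")
      case True
      thus ?thesis using elim lo lohi hi by (auto simp: hi_def \<phi>_def)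
    next
      case False
      hence "hi = 1" by (simp add: hi_def)
      moreover have "real (card (H n)) / real (card (complete_graph n)) < q + \<epsilon> / 2"
        using elim by simp
      ultimately show ?thesis using elim by (simp add: mmse_at_one[OF H(1)])
    qed
    have "\<exists>p. lo \<le> p \<and> p < hi \<and> \<bar>?m p - (1 - q)\<bar> \<le> \<epsilon>"
    proof (cases "1 - q - \<epsilon> \<le> ?m lo")
      case True
      thus ?thesis using mlo lohi \<epsilon> by (intro exI[of _ lo]) auto
    next
      case False
      have "continuous_on {lo..hi} ?m"
        by (rule continuous_on_subset[OF continuous_on_mmse[OF H(1)]]) (use lo hi in auto)
      \<comment> \<open>The target with \<open>3 / 4\<close> is within \<epsilon> of
        \<open>1 - q\<close> but strictly below the bound \<open>mhi\<close> at \<open>hi\<close>.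
        This rules out \<open>p = hi\<close> and keeps \<open>p < 1\<close> even when
        \<open>hi = 1\<close>.\<close>
      hence "\<exists>p. lo \<le> p \<and> p \<le> hi \<and> ?m p = 1 - q - 3 / 4 * \<epsilon>"
        using False mhi \<epsilon> lohi by (intro IVT') auto
      then obtain p where p: "lo \<le> p" "p \<le> hi" "?m p = 1 - q - 3 / 4 * \<epsilon>" by auto
      have "p \<noteq> hi" using p(3) mhi \<epsilon> by auto
      thus ?thesis using p \<epsilon> by (intro exI[of _ p]) auto
    qed
    then obtain p where p: "lo \<le> p" "p < hi" "\<bar>?m p - (1 - q)\<bar> \<le> \<epsilon>" by auto
    have "1 - \<epsilon> \<le> p / \<phi>" using p(1) \<phi> by (simp add: lo_def pos_le_divide_eq)
    moreover have "p / \<phi> \<le> 1 + \<epsilon>" using p(2) \<phi> by (simp add: hi_def pos_divide_le_eq)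
    ultimately have "\<bar>p / \<phi> - 1\<bar> \<le> \<epsilon>" by simp
    moreover have "p \<in> {0<..<1}" using p lo hi by simp
    ultimately show ?case using p(3) unfolding \<phi>_def by blast
  qed
qed

text \<open>Replaces a diagonal choice of rates: \<open>x n\<close> comes within
  \<open>1 / Suc n\<close> of the infimum of \<open>D n\<close>, and the assumption forces these
  infima to 0.\<close>

lemma exists_null_sequence:
  fixes D :: "nat \<Rightarrow> 'a \<Rightarrow> real"
  assumes A: "A \<noteq> {}" and nonneg: "\<And>n x. x \<in> A \<Longrightarrow> 0 \<le> D n x"
    and small: "\<And>\<epsilon>. 0 < \<epsilon> \<Longrightarrow> \<epsilon> < 1 \<Longrightarrow> \<forall>\<^sub>F n in sequentially. \<exists>x\<in>A. D n x \<le> \<epsilon>"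
  shows "\<exists>x. (\<forall>n. x n \<in> A) \<and> (\<lambda>n. D n (x n)) \<longlonglongrightarrow> 0"
proof -
  have bdd: "bdd_below (D n ` A)" for n using nonneg by (intro bdd_belowI2[of _ 0]) auto
  have "\<exists>x\<in>A. D n x < (INF x\<in>A. D n x) + 1 / real (Suc n)" for n
    by (rule cINF_less_iff[OF A bdd[of n], THEN iffD1]) simp
  then obtain x where x: "\<And>n. x n \<in> A" "\<And>n. D n (x n) < (INF x\<in>A. D n x) + 1 / real (Suc n)"
    by metis
  have "(\<lambda>n. D n (x n)) \<longlonglongrightarrow> 0"
  proof (rule tendstoI)
    fix e :: real assume e: "e > 0"
    define \<epsilon> where "\<epsilon> = min (1 / 2) (e / 2)"
    have \<epsilon>: "0 < \<epsilon>" "\<epsilon> < 1" "\<epsilon> \<le> e / 2" using e by (auto simp: \<epsilon>_def)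
    have "\<forall>\<^sub>F n in sequentially. 1 / real (Suc n) < e / 2"
      using order_tendstoD(2)[OF LIMSEQ_inverse_real_of_nat, of "e / 2"] e
      by (simp add: inverse_eq_divide)
    with small[OF \<epsilon>(1,2)] show "\<forall>\<^sub>F n in sequentially. dist (D n (x n)) 0 < e"
    proof eventually_elim
      case (elim n)
      then obtain y where "y \<in> A" "D n y \<le> \<epsilon>" by auto
      hence "(INF x\<in>A. D n x) \<le> e / 2" using cINF_lower[OF bdd, of y n] \<epsilon> by linarith
      thus ?case using x(2)[of n] elim nonneg[OF x(1)[of n], of n] by simp
    qed
  qed
  thus ?thesis using x(1) by blast
qed

theorem theorem3p1:
  fixes H :: "nat \<Rightarrow> graph" and q :: real
  assumes "\<And>n. H n \<subseteq> complete_graph n"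
    and "weakly_dense H"
    and "0 \<le> q" and "q < 1"
  shows
    "(\<forall>p :: nat \<Rightarrow> real. (\<forall>n. 0 < p n \<and> p n < 1) \<longrightarrow>
        liminf (\<lambda>n. ereal (p n / expectation_threshold q n (H n))) > 1 \<longrightarrow>
        liminf (\<lambda>n. ereal (mmse n (H n) (p n))) \<ge> ereal (1 - q)) \<and>
     (\<forall>p :: nat \<Rightarrow> real. (\<forall>n. 0 < p n \<and> p n < 1) \<longrightarrow>
        limsup (\<lambda>n. ereal (p n / expectation_threshold q n (H n))) < 1 \<longrightarrow>
        limsup (\<lambda>n. ereal (mmse n (H n) (p n))) \<le> ereal (1 - q)) \<and>
     (limsup (\<lambda>n. ereal (real (card (H n)) / real (card (complete_graph n)))) \<le> ereal q \<longrightarrow>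
      (\<exists>p :: nat \<Rightarrow> real. (\<forall>n. 0 < p n \<and> p n < 1) \<and>
        (\<lambda>n. p n / expectation_threshold q n (H n)) \<longlonglongrightarrow> 1 \<and>
        (\<lambda>n. mmse n (H n) (p n)) \<longlonglongrightarrow> 1 - q))"
proof (intro conjI allI impI)
  let ?\<phi> = "\<lambda>n. expectation_threshold q n (H n)"
  have \<phi>: "\<forall>\<^sub>F n in sequentially. 0 < ?\<phi> n"
    using eventually_nonempty[OF assms(1,2)]
    by eventually_elim (use assms in \<open>auto intro: expectation_threshold_bounds\<close>)
  fix p :: "nat \<Rightarrow> real" assume p: "\<forall>n. 0 < p n \<and> p n < 1"
  {
    assume "1 < liminf (\<lambda>n. ereal (p n / ?\<phi> n))"
    then obtain r where r: "1 < ereal r" "ereal r < liminf (\<lambda>n. ereal (p n / ?\<phi> n))"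
      using ereal_dense2 by blast
    define \<epsilon> where "\<epsilon> = r - 1"
    have \<epsilon>: "\<epsilon> > 0" using r by (simp add: \<epsilon>_def)
    have above: "\<forall>\<^sub>F n in sequentially. (1 + \<epsilon>) * ?\<phi> n \<le> p n"
      using less_LiminfD[OF r(2)] \<phi>
      by eventually_elim (simp add: \<epsilon>_def pos_less_divide_eq)
    show "ereal (1 - q) \<le> liminf (\<lambda>n. ereal (mmse n (H n) (p n)))"
      unfolding le_Liminf_iff
    proof (intro allI impI)
      fix y assume "y < ereal (1 - q)"
      then obtain z where z: "y < ereal z" "ereal z < ereal (1 - q)" using ereal_dense2 by blast
      hence "1 - q - z > 0" by simp
      from eventually_mmse_lower[OF assms \<epsilon> this] above
      show "\<forall>\<^sub>F n in sequentially. y < ereal (mmse n (H n) (p n))"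
      proof eventually_elim
        case (elim n)
        hence "z \<le> mmse n (H n) (p n)" using p by (simp add: less_imp_le)
        thus ?case using z(1) by (metis ereal_less_eq(3) less_le_trans)
      qed
    qed
  next
    assume "limsup (\<lambda>n. ereal (p n / ?\<phi> n)) < 1"
    \<comment> \<open>The maximum with 0 yields \<open>r > 0\<close>, hence
      \<open>\<epsilon> < 1\<close> as \<open>eventually_mmse_upper\<close> requires.\<close>
    hence "max 0 (limsup (\<lambda>n. ereal (p n / ?\<phi> n))) < 1" by simp
    then obtain r where r: "max 0 (limsup (\<lambda>n. ereal (p n / ?\<phi> n))) < ereal r" "ereal r < 1"
      using ereal_dense2 by blast
    define \<epsilon> where "\<epsilon> = 1 - r"
    have \<epsilon>: "\<epsilon> > 0" "\<epsilon> < 1" using r by (simp_all add: \<epsilon>_def)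
    have "limsup (\<lambda>n. ereal (p n / ?\<phi> n)) < ereal r" using r by simp
    from Limsup_lessD[OF this] \<phi> have below: "\<forall>\<^sub>F n in sequentially. p n \<le> (1 - \<epsilon>) * ?\<phi> n"
      by eventually_elim (simp add: \<epsilon>_def pos_divide_less_eq)
    show "limsup (\<lambda>n. ereal (mmse n (H n) (p n))) \<le> ereal (1 - q)"
      unfolding Limsup_le_iff
    proof (intro allI impI)
      fix y assume "ereal (1 - q) < y"
      then obtain z where z: "ereal (1 - q) < ereal z" "ereal z < y" using ereal_dense2 by blast
      hence "z - (1 - q) > 0" by simp
      from eventually_mmse_upper[OF assms \<epsilon> this] below
      show "\<forall>\<^sub>F n in sequentially. ereal (mmse n (H n) (p n)) < y"
      proof eventually_elim
        case (elim n)
        hence "mmse n (H n) (p n) \<le> z" using p by (simp add: less_imp_le)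
        thus ?case using z(2) by (metis ereal_less_eq(3) le_less_trans)
      qed
    qed
  }
next
  let ?\<phi> = "\<lambda>n. expectation_threshold q n (H n)"
  assume dens: "limsup (\<lambda>n. ereal (real (card (H n)) / real (card (complete_graph n)))) \<le> ereal q"
  \<comment> \<open>Both deviations are put into one maximum so that a single sequence serves both
    limits.\<close>
  let ?D = "\<lambda>n p. max \<bar>p / ?\<phi> n - 1\<bar> \<bar>mmse n (H n) p - (1 - q)\<bar>"
  have "\<exists>p. (\<forall>n. p n \<in> {0<..<1::real}) \<and> (\<lambda>n. ?D n (p n)) \<longlonglongrightarrow> 0"
  proof (rule exists_null_sequence)
    show "{0<..<1::real} \<noteq> {}" by simp
    show "\<forall>\<^sub>F n in sequentially. \<exists>p\<in>{0<..<1}. ?D n p \<le> \<epsilon>" if "0 < \<epsilon>" "\<epsilon> < 1" for \<epsilon>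
      using eventually_near_critical[OF assms dens that] by simp
  qed auto
  then obtain p where p: "\<And>n. p n \<in> {0<..<1::real}" "(\<lambda>n. ?D n (p n)) \<longlonglongrightarrow> 0" by auto
  have "(\<lambda>n. p n / ?\<phi> n - 1) \<longlonglongrightarrow> 0" "(\<lambda>n. mmse n (H n) (p n) - (1 - q)) \<longlonglongrightarrow> 0"
    by (rule Lim_null_comparison[OF _ p(2)], simp)+
  hence "(\<lambda>n. p n / ?\<phi> n) \<longlonglongrightarrow> 1" "(\<lambda>n. mmse n (H n) (p n)) \<longlonglongrightarrow> 1 - q"
    by (simp_all add: LIM_zero_iff)
  thus "\<exists>p :: nat \<Rightarrow> real. (\<forall>n. 0 < p n \<and> p n < 1) \<and> (\<lambda>n. p n / ?\<phi> n) \<longlonglongrightarrow> 1 \<and>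
      (\<lambda>n. mmse n (H n) (p n)) \<longlonglongrightarrow> 1 - q"
    using p(1) by (intro exI[of _ p]) auto
qed

end
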